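(* Let $(\mathcal{C},\lambda)$ be a $(2n+1)$-dimensional contact manifold with canonical coordinates $(x,p,z)$, $\lambda=dz-p_a\,dx^a$, let $\psi$ be a function of $x$ only, and let $\mathcal{A}_\psi$ be the Legendre submanifold generated by $\psi$. Let $F^1,\dots,F^n$ be functions of $x$ on $\mathcal{A}_\psi$ which do not identically vanish, and consider on $\mathcal{A}_\psi$ the vector field $\check X=\dot x^a\,\partial/\partial x^a$, $\dot x^a=F^a(x)$. Let $\Gamma$ be a function of one variable. Then the flow of $\check X$ is lifted to $\mathcal{C}$ as the flow of the vector field $X_h=\dot x^a\frac{\partial}{\partial x^a}+\dot p_a\frac{\partial}{\partial p_a}+\dot z\frac{\partial}{\partial z}$ whose components satisfy $$\frac{dx^a}{dt}=F^a(x),\qquad \frac{d\Delta_a}{dt}=-\frac{\partial F^b}{\partial x^a}\Delta_b-\frac{d\Gamma}{d\Delta_0}\Delta_a,\qquad \frac{d\Delta_0}{dt}=-\Gamma(\Delta_0),$$ and this $X_h$ is the contact Hamiltonian vector field associated to the contact Hamiltonian $$h(x,p,z)=\Delta_a(x,p)F^a(x)+\Gamma(\Delta_0(x,z)).$$ In addition, if $\Gamma(0)=0$ and $\Gamma(s)\neq0$ for $s\neq0$, then $X^0:=X_h|_{\Delta_0=\Delta_1=\dots=\Delta_n=0}$ is tangent to $\mathcal{A}_\psi^{\mathcal{C}}$, and $\pi_*X_h=\check X$, $\Phi_*\check X=X^0$.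
   Context: All objects are smooth, repeated indices are summed over $1,\dots,n$, and everything is expressed in the canonical coordinates $(x,p,z)$. Put $\Delta_0(x,z)=\psi(x)-z$ and $\Delta_a(x,p)=\frac{\partial\psi}{\partial x^a}(x)-p_a$. The Legendre submanifold $\mathcal{A}_\psi$ generated by $\psi$ is parametrized by $x$; $\Phi:\mathcal{A}_\psi\to\mathcal{C}$, $x\mapsto(x,\partial\psi/\partial x,\psi(x))$ is its embedding, with image $\mathcal{A}_\psi^{\mathcal{C}}=\{\Delta_0=\Delta_1=\dots=\Delta_n=0\}$; and $\pi:\mathcal{C}\to\mathcal{A}_\psi$ is the projection $\pi(x,p,z)=x$. A flow $\Phi^{\mathcal{N}}_t$ on $\mathcal{N}$ is a lift of a flow $\Phi^{\mathcal{M}}_t$ on $\mathcal{M}$ along a projection $\pi:\mathcal{N}\to\mathcal{M}$ ($\dim\mathcal{M}<\dim\mathcal{N}$) if $\Phi^{\mathcal{M}}_t\circ\pi=\pi\circ\Phi^{\mathcal{N}}_t$; here $\mathcal{N}=\mathcal{C}$, $\mathcal{M}=\mathcal{A}_\psi$. The contact Hamiltonian vector field $X_h$ of a function $h$ is defined by $\iota_{X_h}\lambda=h$, $\iota_{X_h}d\lambda=-(dh-(\mathcal{R}h)\lambda)$ with $\mathcal{R}=\partial/\partial z$; in coordinates $\dot x^a=-\partial h/\partial p_a$, $\dot p_a=\partial h/\partial x^a+p_a\,\partial h/\partial z$, $\dot z=h-p_a\,\partial h/\partial p_a$. *)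

theory Defs
  imports "HOL-Analysis.Analysis"
begin

section \<open>Smooth maps\<close>

primrec Ck_on :: "nat \<Rightarrow> ('a::real_normed_vector) set \<Rightarrow> ('a \<Rightarrow> 'b::real_normed_vector) \<Rightarrow> bool" where
  "Ck_on 0 S f \<longleftrightarrow> continuous_on S f"
| "Ck_on (Suc k) S f \<longleftrightarrow> (\<forall>x\<in>S. f differentiable at x) \<and>
     (\<forall>v. Ck_on k S (\<lambda>x. frechet_derivative f (at x) v))"

text \<open>Only used on open sets \<open>S\<close>.\<close>
definition smooth_on :: "('a::real_normed_vector) set \<Rightarrow> ('a \<Rightarrow> 'b::real_normed_vector) \<Rightarrow> bool" where
  "smooth_on S f \<longleftrightarrow> (\<forall>k. Ck_on k S f)"

section \<open>Vector fields, flows, tangent vectors\<close>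

text \<open>A vector field on an open subset of a normed space is a map into that space.
  The derivative of \<open>f\<close> along \<open>X\<close>; this is the meaning of \<open>df/dt\<close> for a function \<open>f\<close> on the
  space that carries the vector field.\<close>
definition lie :: "('a::real_normed_vector \<Rightarrow> 'a) \<Rightarrow> ('a \<Rightarrow> real) \<Rightarrow> 'a \<Rightarrow> real" where
  "lie X f u = frechet_derivative f (at u) (X u)"

definition integral_curve ::
    "('a::real_normed_vector \<Rightarrow> 'a) \<Rightarrow> 'a set \<Rightarrow> real set \<Rightarrow> (real \<Rightarrow> 'a) \<Rightarrow> bool" where
  "integral_curve X M I \<gamma> \<longleftrightarrow> open I \<and> is_interval I \<and>
     (\<forall>t\<in>I. \<gamma> t \<in> M \<and> (\<gamma> has_vector_derivative X (\<gamma> t)) (at t))"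

text \<open>The maximal flow of a vector field that need not be complete: \<open>flow_dom X M\<close> is the set of
  all \<open>(t, m)\<close> for which the solution starting in \<open>m\<close> exists up to time \<open>t\<close>. The value \<open>flow X M t m\<close>
  is meaningful for \<open>(t, m) \<in> flow_dom X M\<close> when solutions are unique, as they are for smooth \<open>X\<close>.\<close>
definition flow_dom :: "('a::real_normed_vector \<Rightarrow> 'a) \<Rightarrow> 'a set \<Rightarrow> (real \<times> 'a) set" where
  "flow_dom X M = {(t, m). \<exists>I \<gamma>. integral_curve X M I \<gamma> \<and> 0 \<in> I \<and> t \<in> I \<and> \<gamma> 0 = m}"

definition flow :: "('a::real_normed_vector \<Rightarrow> 'a) \<Rightarrow> 'a set \<Rightarrow> real \<Rightarrow> 'a \<Rightarrow> 'a" where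
  "flow X M t m =
     (THE y. \<exists>I \<gamma>. integral_curve X M I \<gamma> \<and> 0 \<in> I \<and> t \<in> I \<and> \<gamma> 0 = m \<and> \<gamma> t = y)"

text \<open>The flow of \<open>X\<close> on \<open>N\<close> is a lift along \<open>pr\<close> of the flow of \<open>Y\<close> on \<open>M\<close>. The flows may be
  incomplete, so \<open>flow\<^sub>M t \<circ> pr = pr \<circ> flow\<^sub>N t\<close> is required wherever \<open>flow\<^sub>N t\<close> is defined; that
  \<open>flow\<^sub>M t\<close> is defined at the projected point is part of the requirement.\<close>
definition flow_lift :: "('b::real_normed_vector \<Rightarrow> 'a::real_normed_vector) \<Rightarrow>
    ('b \<Rightarrow> 'b) \<Rightarrow> 'b set \<Rightarrow> ('a \<Rightarrow> 'a) \<Rightarrow> 'a set \<Rightarrow> bool" where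
  "flow_lift pr X N Y M \<longleftrightarrow> pr ` N \<subseteq> M \<and>
     (\<forall>t u. (t, u) \<in> flow_dom X N \<longrightarrow>
        (t, pr u) \<in> flow_dom Y M \<and> flow Y M t (pr u) = pr (flow X N t u))"

definition tangent_space :: "('a::real_normed_vector) set \<Rightarrow> 'a \<Rightarrow> 'a set" where
  "tangent_space S u = {v. \<exists>e>0. \<exists>\<gamma>. smooth_on {-e<..<e} \<gamma> \<and> \<gamma> ` {-e<..<e} \<subseteq> S \<and>
     \<gamma> 0 = u \<and> (\<gamma> has_vector_derivative v) (at 0)}"

definition tangent_to :: "('a::real_normed_vector \<Rightarrow> 'a) \<Rightarrow> 'a set \<Rightarrow> bool" where
  "tangent_to X S \<longleftrightarrow> (\<forall>u\<in>S. X u \<in> tangent_space S u)"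

text \<open>\<open>f\<^sub>* X = Y\<close>, for \<open>f\<close> from \<open>M\<close> onto \<open>N\<close>, \<open>X\<close> a vector field on \<open>M\<close> and \<open>Y\<close> one on (or along) \<open>N\<close>.\<close>
definition pushes_forward :: "('a::real_normed_vector \<Rightarrow> 'b::real_normed_vector) \<Rightarrow>
    'a set \<Rightarrow> 'b set \<Rightarrow> ('a \<Rightarrow> 'a) \<Rightarrow> ('b \<Rightarrow> 'b) \<Rightarrow> bool" where
  "pushes_forward f M N X Y \<longleftrightarrow> f ` M = N \<and>
     (\<forall>m\<in>M. f differentiable at m \<and> frechet_derivative f (at m) (X m) = Y (f m))"

section \<open>Contact geometry in canonical coordinates \<open>(x, p, z)\<close>\<close>

type_synonym 'n contact_pt = "(real^'n) \<times> (real^'n) \<times> real"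

definition contact_form :: "'n::finite contact_pt \<Rightarrow> 'n contact_pt \<Rightarrow> real" where
  "contact_form = (\<lambda>(x, p, z) (dx, dp, dz). dz - (\<Sum>a\<in>UNIV. p $ a * dx $ a))"

text \<open>Exterior derivative of a 1-form on a normed space:
  \<open>d\<alpha>(v, w) = v(\<alpha>(w)) - w(\<alpha>(v))\<close> for constant vector fields \<open>v\<close>, \<open>w\<close>.\<close>
definition ext_deriv ::
    "('a::real_normed_vector \<Rightarrow> 'a \<Rightarrow> real) \<Rightarrow> 'a \<Rightarrow> 'a \<Rightarrow> 'a \<Rightarrow> real" where
  "ext_deriv \<alpha> u v w =
     frechet_derivative (\<lambda>m. \<alpha> m w) (at u) v - frechet_derivative (\<lambda>m. \<alpha> m v) (at u) w"

definition reeb :: "'n::finite contact_pt \<Rightarrow> 'n contact_pt" where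
  "reeb u = (0, 0, 1)"

text \<open>\<open>\<iota>\<^sub>X \<lambda> = h\<close> and \<open>\<iota>\<^sub>X d\<lambda> = - (dh - (\<R> h) \<lambda>)\<close> on \<open>C\<close>.\<close>
definition contact_hamiltonian_vf ::
    "'n::finite contact_pt set \<Rightarrow> ('n contact_pt \<Rightarrow> real) \<Rightarrow> ('n contact_pt \<Rightarrow> 'n contact_pt) \<Rightarrow> bool" where
  "contact_hamiltonian_vf C h X \<longleftrightarrow> (\<forall>u\<in>C.
     contact_form u (X u) = h u \<and>
     (\<forall>w. ext_deriv contact_form u (X u) w =
        - (frechet_derivative h (at u) w - lie reeb h u * contact_form u w)))"

section \<open>The Legendre submanifold generated by \<open>\<psi>\<close>\<close>

definition pderiv_vec :: "((real^'n::finite) \<Rightarrow> real) \<Rightarrow> 'n \<Rightarrow> real^'n \<Rightarrow> real" where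
  "pderiv_vec f a x = frechet_derivative f (at x) (axis a 1)"

definition proj_x :: "'n::finite contact_pt \<Rightarrow> real^'n" where
  "proj_x = (\<lambda>(x, p, z). x)"

definition legendre_emb :: "((real^'n::finite) \<Rightarrow> real) \<Rightarrow> real^'n \<Rightarrow> 'n contact_pt" where
  "legendre_emb \<psi> x = (x, (\<chi> a. pderiv_vec \<psi> a x), \<psi> x)"

definition Delta0 :: "((real^'n::finite) \<Rightarrow> real) \<Rightarrow> 'n contact_pt \<Rightarrow> real" where
  "Delta0 \<psi> = (\<lambda>(x, p, z). \<psi> x - z)"

definition Delta :: "((real^'n::finite) \<Rightarrow> real) \<Rightarrow> 'n \<Rightarrow> 'n contact_pt \<Rightarrow> real" where
  "Delta \<psi> a = (\<lambda>(x, p, z). pderiv_vec \<psi> a x - p $ a)"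

definition legendre_image ::
    "'n::finite contact_pt set \<Rightarrow> ((real^'n) \<Rightarrow> real) \<Rightarrow> 'n contact_pt set" where
  "legendre_image C \<psi> = {u \<in> C. Delta0 \<psi> u = 0 \<and> (\<forall>a. Delta \<psi> a u = 0)}"

definition lift_equations :: "'n::finite contact_pt set \<Rightarrow> ((real^'n) \<Rightarrow> real) \<Rightarrow>
    (real^'n \<Rightarrow> real^'n) \<Rightarrow> (real \<Rightarrow> real) \<Rightarrow> ('n contact_pt \<Rightarrow> 'n contact_pt) \<Rightarrow> bool" where
  "lift_equations C \<psi> F \<Gamma> X \<longleftrightarrow> (\<forall>u\<in>C.
     (\<forall>a. lie X (\<lambda>u. proj_x u $ a) u = F (proj_x u) $ a) \<and>
     (\<forall>a. lie X (Delta \<psi> a) u =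
        - (\<Sum>b\<in>UNIV. pderiv_vec (\<lambda>x. F x $ b) a (proj_x u) * Delta \<psi> b u)
        - deriv \<Gamma> (Delta0 \<psi> u) * Delta \<psi> a u) \<and>
     lie X (Delta0 \<psi>) u = - \<Gamma> (Delta0 \<psi> u))"

definition lift_hamiltonian :: "((real^'n::finite) \<Rightarrow> real) \<Rightarrow>
    (real^'n \<Rightarrow> real^'n) \<Rightarrow> (real \<Rightarrow> real) \<Rightarrow> 'n contact_pt \<Rightarrow> real" where
  "lift_hamiltonian \<psi> F \<Gamma> u =
     (\<Sum>a\<in>UNIV. Delta \<psi> a u * F (proj_x u) $ a) + \<Gamma> (Delta0 \<psi> u)"

end

theory Submission
  imports Defs
begin

text \<open>
  The lift equations are linear in the unknown vector field and triangular: the \<open>x\<close> component is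
  \<open>F\<close>, and the equations for \<open>\<Delta>\<^sub>a\<close> and \<open>\<Delta>\<^sub>0\<close> then give the \<open>p\<close> and \<open>z\<close> components. This
  determines the field, and computing \<open>\<iota>\<^sub>X \<lambda>\<close> and \<open>\<iota>\<^sub>X d\<lambda>\<close> for it yields the contact Hamiltonian
  equations of \<open>h\<close>; the only non-formal step is the symmetry of the second derivatives of \<open>\<psi>\<close>.
  Since the field projects to \<open>F\<close>, its integral curves project to integral curves of \<open>F\<close>, and
  uniqueness of solutions identifies the flows. On \<open>\<Delta>\<^sub>0 = \<Delta>\<^sub>a = 0\<close> with \<open>\<Gamma> 0 = 0\<close> the field is
  the derivative of the embedding applied to \<open>F\<close>, hence tangent to the image.
\<close>

section \<open>Calculus of \<open>C\<^sup>k\<close> maps\<close>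

lemma Ck_on_Suc_has_derivative:
  assumes "Ck_on (Suc k) S f" "x \<in> S"
  shows "(f has_derivative frechet_derivative f (at x)) (at x)"
  using assms by (simp flip: frechet_derivative_works)

text \<open>On an open set, agreement near each point forces equal derivatives there, so values
  outside \<open>S\<close> do not matter although \<open>frechet_derivative\<close> acts on total
  functions. The induction generalises over both maps because they are replaced by their directional
  derivatives.\<close>

lemma Ck_on_cong:
  assumes "open S" "Ck_on k S f" "\<And>x. x \<in> S \<Longrightarrow> f x = g x"
  shows "Ck_on k S g"
  using assms(2,3)
proof (induction k arbitrary: f g)
  case 0
  then show ?case using continuous_on_cong[of S S f g] by simp
next
  case (Suc k)
  have der: "(g has_derivative frechet_derivative f (at x)) (at x)" if "x \<in> S" for x
    using Ck_on_Suc_has_derivative[OF Suc.prems(1) that] assms(1) that Suc.prems(2)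
    by (rule has_derivative_transform_within_open)
  have "g differentiable at x" if "x \<in> S" for x
    using der[OF that] by (rule differentiableI)
  moreover have "Ck_on k S (\<lambda>x. frechet_derivative g (at x) v)" for v
  proof (rule Suc.IH)
    show "Ck_on k S (\<lambda>x. frechet_derivative f (at x) v)"
      using Suc.prems(1) by simp
    show "frechet_derivative f (at x) v = frechet_derivative g (at x) v" if "x \<in> S" for x
      using frechet_derivative_at[OF der[OF that]] by simp
  qed
  ultimately show ?case by simp
qed

text \<open>Lets the closure lemmas below work with any explicit candidate for the derivative
  instead of evaluating \<open>frechet_derivative\<close>; uniqueness of derivatives at interior
  points identifies the two.\<close>

lemma Ck_on_SucI:
  assumes "open S" "\<And>x. x \<in> S \<Longrightarrow> (f has_derivative f' x) (at x)"
    "\<And>v. Ck_on k S (\<lambda>x. f' x v)"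
  shows "Ck_on (Suc k) S f"
proof -
  have "f differentiable at x" "f' x = frechet_derivative f (at x)" if "x \<in> S" for x
    using differentiableI[OF assms(2)[OF that]] frechet_derivative_at[OF assms(2)[OF that]] by simp_all
  then show ?thesis
    using Ck_on_cong[OF assms(1) assms(3)] by simp
qed

text \<open>The recursion strips derivatives from the outside, so lowering the order is itself an
  induction, ending in "differentiable implies continuous".\<close>

lemma Ck_on_Suc_imp: "Ck_on (Suc k) S f \<Longrightarrow> Ck_on k S f"
proof (induction k arbitrary: f)
  case 0
  then show ?case
    by (simp add: differentiable_imp_continuous_on differentiable_on_def differentiable_at_withinI)
next
  case (Suc k)
  have "Ck_on k S (\<lambda>x. frechet_derivative f (at x) v)" for v
  proof (rule Suc.IH)
    show "Ck_on (Suc k) S (\<lambda>x. frechet_derivative f (at x) v)"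
      using Suc.prems by (subst (asm) Ck_on.simps(2)) blast
  qed
  with Suc.prems show ?case by simp
qed

lemma Ck_on_const: "Ck_on k S (\<lambda>x. c)"
  by (induction k arbitrary: c) auto

lemma Ck_on_bounded_linear:
  assumes "open S" "bounded_linear L" "Ck_on k S f"
  shows "Ck_on k S (\<lambda>x. L (f x))"
  using assms(3)
proof (induction k arbitrary: f)
  case 0
  then show ?case using bounded_linear.continuous_on[OF assms(2)] by auto
next
  case (Suc k)
  show ?case
  proof (rule Ck_on_SucI[OF assms(1)])
    show "((\<lambda>x. L (f x)) has_derivative (\<lambda>v. L (frechet_derivative f (at x) v))) (at x)" if "x \<in> S" for x
      using bounded_linear.has_derivative[OF assms(2) Ck_on_Suc_has_derivative[OF Suc.prems that]] .
    show "Ck_on k S (\<lambda>x. L (frechet_derivative f (at x) v))" for v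
      using Suc.prems by (intro Suc.IH) simp
  qed
qed

lemma bounded_linear_Ck_on:
  assumes "open S" "bounded_linear L"
  shows "Ck_on k S L"
proof (cases k)
  case 0
  then show ?thesis using linear_continuous_on[OF assms(2)] by simp
next
  case (Suc m)
  show ?thesis unfolding Suc
    by (rule Ck_on_SucI[OF assms(1) bounded_linear_imp_has_derivative[OF assms(2)] Ck_on_const])
qed

lemma Ck_on_add:
  assumes "open S" "Ck_on k S f" "Ck_on k S g"
  shows "Ck_on k S (\<lambda>x. f x + g x)"
  using assms(2,3)
proof (induction k arbitrary: f g)
  case 0
  then show ?case by (simp add: continuous_on_add)
next
  case (Suc k)
  show ?case
  proof (rule Ck_on_SucI[OF assms(1)])
    show "((\<lambda>x. f x + g x) has_derivative
        (\<lambda>v. frechet_derivative f (at x) v + frechet_derivative g (at x) v)) (at x)" if "x \<in> S" for x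
      using that Suc.prems by (intro has_derivative_add Ck_on_Suc_has_derivative)
    show "Ck_on k S (\<lambda>x. frechet_derivative f (at x) v + frechet_derivative g (at x) v)" for v
      using Suc.prems by (intro Suc.IH) simp_all
  qed
qed

lemma Ck_on_sum:
  assumes "open S" "\<And>i. i \<in> A \<Longrightarrow> Ck_on k S (f i)"
  shows "Ck_on k S (\<lambda>x. \<Sum>i\<in>A. f i x)"
  using assms(2)
  by (induction A rule: infinite_finite_induct) (auto intro: Ck_on_const Ck_on_add assms(1))

lemma Ck_on_diff:
  assumes "open S" "Ck_on k S f" "Ck_on k S g"
  shows "Ck_on k S (\<lambda>x. f x - g x)"
  using Ck_on_add[OF assms(1,2) Ck_on_bounded_linear[OF assms(1) bounded_linear_minus[OF bounded_linear_ident] assms(3)]]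
  by simp

text \<open>Product rule. In each summand one factor stays undifferentiated and is of order
  \<open>Suc k\<close>; \<open>Ck_on_Suc_imp\<close> lowers it so that the induction hypothesis
  applies.\<close>

lemma Ck_on_scaleR:
  assumes "open S" "Ck_on k S f" "Ck_on k S g"
  shows "Ck_on k S (\<lambda>x. f x *\<^sub>R g x)"
  using assms(2,3)
proof (induction k arbitrary: f g)
  case 0
  then show ?case by (simp add: continuous_on_scaleR)
next
  case (Suc k)
  note IH = Suc.IH and f = Suc.prems(1) and g = Suc.prems(2)
  show ?case
  proof (rule Ck_on_SucI[OF assms(1)])
    show "((\<lambda>x. f x *\<^sub>R g x) has_derivative
        (\<lambda>v. f x *\<^sub>R frechet_derivative g (at x) v + frechet_derivative f (at x) v *\<^sub>R g x)) (at x)"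
      if "x \<in> S" for x
      using has_derivative_scaleR[OF Ck_on_Suc_has_derivative[OF f that] Ck_on_Suc_has_derivative[OF g that]] .
    fix v
    have "Ck_on k S (\<lambda>x. frechet_derivative f (at x) v)" "Ck_on k S (\<lambda>x. frechet_derivative g (at x) v)"
      using f g by simp_all
    then show "Ck_on k S (\<lambda>x. f x *\<^sub>R frechet_derivative g (at x) v + frechet_derivative f (at x) v *\<^sub>R g x)"
      by (rule Ck_on_add[OF assms(1) IH[OF Ck_on_Suc_imp[OF f]] IH[OF _ Ck_on_Suc_imp[OF g]], rotated])
  qed
qed

lemma Ck_on_mult:
  fixes f g :: "'a::real_normed_vector \<Rightarrow> real"
  shows "open S \<Longrightarrow> Ck_on k S f \<Longrightarrow> Ck_on k S g \<Longrightarrow> Ck_on k S (\<lambda>x. f x * g x)"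
  using Ck_on_scaleR[of S k f g] by simp

text \<open>Reduces to sums and bounded linear maps by writing the pair as (f, 0) + (0, g).\<close>

lemma Ck_on_Pair:
  assumes "open S" "Ck_on k S f" "Ck_on k S g"
  shows "Ck_on k S (\<lambda>x. (f x, g x))"
  using Ck_on_add[OF assms(1)
      Ck_on_bounded_linear[OF assms(1) bounded_linear_Pair[OF bounded_linear_ident bounded_linear_zero] assms(2)]
      Ck_on_bounded_linear[OF assms(1) bounded_linear_Pair[OF bounded_linear_zero bounded_linear_ident] assms(3)]]
  by simp

lemma Ck_on_vec_lambda:
  fixes f :: "'n::finite \<Rightarrow> 'a::real_normed_vector \<Rightarrow> real"
  assumes "open S" "\<And>a. Ck_on k S (f a)"
  shows "Ck_on k S (\<lambda>x. \<chi> a. f a x)"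
proof -
  have "(\<lambda>x. \<chi> a. f a x) = (\<lambda>x. \<Sum>a\<in>UNIV. f a x *\<^sub>R axis a 1)"
    by (simp add: fun_eq_iff vec_eq_iff axis_def if_distrib cong: if_cong)
  then show ?thesis
    by (auto intro!: Ck_on_sum Ck_on_scaleR Ck_on_const assms)
qed

lemma linear_Basis_expansion:
  fixes f :: "'a::euclidean_space \<Rightarrow> 'b::real_normed_vector"
  assumes "linear f"
  shows "f v = (\<Sum>b\<in>Basis. (v \<bullet> b) *\<^sub>R f b)"
proof -
  have "f v = f (\<Sum>b\<in>Basis. (v \<bullet> b) *\<^sub>R b)"
    by (simp add: euclidean_representation)
  then show ?thesis
    using assms by (simp add: linear_sum linear_scale)
qed

text \<open>The chain rule applies the derivative of \<open>f\<close> to a direction that varies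
  with \<open>x\<close>, whereas \<open>Ck_on\<close> controls fixed directions only. Expanding that
  direction in \<open>Basis\<close> separates a scalar coefficient from a derivative in a fixed
  direction; this is where the intermediate space is Euclidean.\<close>

lemma Ck_on_compose:
  fixes g :: "'a::real_normed_vector \<Rightarrow> 'b::euclidean_space"
    and f :: "'b \<Rightarrow> 'c::real_normed_vector"
  assumes "open S" "open T" "g ` S \<subseteq> T" "Ck_on k T f" "Ck_on k S g"
  shows "Ck_on k S (\<lambda>x. f (g x))"
  using assms(4,5)
proof (induction k arbitrary: f)
  case 0
  then show ?case using assms(3) by (auto intro: continuous_on_compose2)
next
  case (Suc k)
  note f = Suc.prems(1) and g = Suc.prems(2)
  show ?case
  proof (rule Ck_on_SucI[OF assms(1)])
    fix x assume x: "x \<in> S"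
    have gx: "g x \<in> T" using x assms(3) by auto
    have "((\<lambda>x. f (g x)) has_derivative
        (\<lambda>v. frechet_derivative f (at (g x)) (frechet_derivative g (at x) v))) (at x)"
      using diff_chain_at[OF Ck_on_Suc_has_derivative[OF g x] Ck_on_Suc_has_derivative[OF f gx]]
      by (simp add: o_def)
    moreover have "linear (frechet_derivative f (at (g x)))"
      using f gx by (auto intro: linear_frechet_derivative)
    ultimately show "((\<lambda>x. f (g x)) has_derivative (\<lambda>v. \<Sum>b\<in>Basis.
        (frechet_derivative g (at x) v \<bullet> b) *\<^sub>R frechet_derivative f (at (g x)) b)) (at x)"
      by (subst (asm) linear_Basis_expansion) auto
  next
    have "Ck_on k S (\<lambda>x. frechet_derivative f (at (g x)) b)" for b
      using Suc.IH[of "\<lambda>y. frechet_derivative f (at y) b"] f Ck_on_Suc_imp[OF g] by auto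
    then show "Ck_on k S (\<lambda>x. \<Sum>b\<in>Basis.
        (frechet_derivative g (at x) v \<bullet> b) *\<^sub>R frechet_derivative f (at (g x)) b)" for v
      using g by (intro Ck_on_sum Ck_on_scaleR assms(1)
          Ck_on_bounded_linear[OF assms(1) bounded_linear_inner_left]) auto
  qed
qed

text \<open>Same expansion as for composition, with the moving direction given by a vector field; it
  will handle the derivatives of \<psi> and of its partials along \<open>F\<close>.\<close>

lemma Ck_on_frechet_derivative:
  fixes f :: "'a::euclidean_space \<Rightarrow> 'b::real_normed_vector"
  assumes "open S" "Ck_on (Suc k) S f" "Ck_on k S X"
  shows "Ck_on k S (\<lambda>x. frechet_derivative f (at x) (X x))"
proof (rule Ck_on_cong[OF assms(1)])
  show "Ck_on k S (\<lambda>x. \<Sum>b\<in>Basis. (X x \<bullet> b) *\<^sub>R frechet_derivative f (at x) b)"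
    using assms(2,3) by (intro Ck_on_sum Ck_on_scaleR assms(1)
        Ck_on_bounded_linear[OF assms(1) bounded_linear_inner_left]) auto
  show "(\<Sum>b\<in>Basis. (X x \<bullet> b) *\<^sub>R frechet_derivative f (at x) b) = frechet_derivative f (at x) (X x)"
    if "x \<in> S" for x
    using linear_Basis_expansion[of "frechet_derivative f (at x)" "X x"] assms(2) that
    by (simp add: linear_frechet_derivative)
qed

section \<open>From finite order to smooth maps\<close>

lemma smooth_onD: "smooth_on S f \<Longrightarrow> Ck_on k S f"
  by (simp add: smooth_on_def)

lemma smooth_on_differentiable: "smooth_on S f \<Longrightarrow> x \<in> S \<Longrightarrow> f differentiable at x"
  using smooth_onD[of S f 1] by simp

lemma smooth_on_has_derivative:
  "smooth_on S f \<Longrightarrow> x \<in> S \<Longrightarrow> (f has_derivative frechet_derivative f (at x)) (at x)"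
  using smooth_on_differentiable frechet_derivative_works by blast

lemma smooth_on_frechet_derivative: "smooth_on S f \<Longrightarrow> smooth_on S (\<lambda>x. frechet_derivative f (at x) v)"
  unfolding smooth_on_def by (metis Ck_on.simps(2))

lemma smooth_on_compose:
  fixes g :: "'a::real_normed_vector \<Rightarrow> 'b::euclidean_space"
  shows "open S \<Longrightarrow> open T \<Longrightarrow> g ` S \<subseteq> T \<Longrightarrow> smooth_on T f \<Longrightarrow> smooth_on S g \<Longrightarrow> smooth_on S (\<lambda>x. f (g x))"
  unfolding smooth_on_def by (blast intro: Ck_on_compose)

section \<open>Symmetry of second derivatives\<close>

text \<open>The mean value theorem used twice, first along \<open>v\<close> and then along
  \<open>w\<close>, turns the second difference over a parallelogram into a mixed derivative at some
  point of it.\<close>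

lemma second_difference_mean_value:
  fixes f :: "'a::real_normed_vector \<Rightarrow> real"
  assumes f: "Ck_on 2 S f" and s: "0 < s"
    and box: "\<And>p q. 0 \<le> p \<Longrightarrow> p \<le> s \<Longrightarrow> 0 \<le> q \<Longrightarrow> q \<le> s \<Longrightarrow> x + p *\<^sub>R v + q *\<^sub>R w \<in> S"
  obtains p q where "0 \<le> p" "p \<le> s" "0 \<le> q" "q \<le> s"
    "f (x + s *\<^sub>R v + s *\<^sub>R w) - f (x + s *\<^sub>R v) - f (x + s *\<^sub>R w) + f x =
     s\<^sup>2 * frechet_derivative (\<lambda>y. frechet_derivative f (at y) v) (at (x + p *\<^sub>R v + q *\<^sub>R w)) w"
proof -
  define g where "g = (\<lambda>y. frechet_derivative f (at y) v)"
  have f': "(f has_derivative frechet_derivative f (at y)) (at y)"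
    and g': "(g has_derivative frechet_derivative g (at y)) (at y)" if "y \<in> S" for y
    using f that by (simp_all add: g_def eval_nat_numeral flip: frechet_derivative_works)
  have df: "((\<lambda>p. f (x + p *\<^sub>R v + q *\<^sub>R w)) has_real_derivative g (x + p *\<^sub>R v + q *\<^sub>R w)) (at p)"
    if "0 \<le> p" "p \<le> s" "0 \<le> q" "q \<le> s" for p q
  proof -
    have "((\<lambda>p. x + p *\<^sub>R v + q *\<^sub>R w) has_derivative (\<lambda>h. h *\<^sub>R v)) (at p)"
      by (auto intro!: derivative_eq_intros)
    from diff_chain_at[OF this f'[OF box[OF that]]]
    show ?thesis
      using linear_frechet_derivative[OF differentiableI[OF f'[OF box[OF that]]]]
      by (auto simp: has_field_derivative_def o_def g_def linear_scale mult_commute_abs)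
  qed
  have dg: "((\<lambda>q. g (x + p *\<^sub>R v + q *\<^sub>R w)) has_real_derivative
      frechet_derivative g (at (x + p *\<^sub>R v + q *\<^sub>R w)) w) (at q)"
    if "0 \<le> p" "p \<le> s" "0 \<le> q" "q \<le> s" for p q
  proof -
    have "((\<lambda>q. x + p *\<^sub>R v + q *\<^sub>R w) has_derivative (\<lambda>h. h *\<^sub>R w)) (at q)"
      by (auto intro!: derivative_eq_intros)
    from diff_chain_at[OF this g'[OF box[OF that]]]
    show ?thesis
      using linear_frechet_derivative[OF differentiableI[OF g'[OF box[OF that]]]]
      by (auto simp: has_field_derivative_def o_def linear_scale mult_commute_abs)
  qed
  \<comment> \<open>The outer function of \<open>p\<close> is the difference between the two
    opposite edges of the parallelogram; the term \<open>0 *\<^sub>R w\<close> makes the lower edge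
    another instance of \<open>df\<close>.\<close>
  have "((\<lambda>p. f (x + p *\<^sub>R v + s *\<^sub>R w) - f (x + p *\<^sub>R v + 0 *\<^sub>R w)) has_real_derivative
      g (x + p *\<^sub>R v + s *\<^sub>R w) - g (x + p *\<^sub>R v + 0 *\<^sub>R w)) (at p)" if "0 \<le> p" "p \<le> s" for p
    using df[OF that, of s] df[OF that, of 0] s by (intro DERIV_diff) auto
  from MVT2[OF s this] obtain p where p: "0 < p" "p < s"
    "f (x + s *\<^sub>R v + s *\<^sub>R w) - f (x + s *\<^sub>R v) - (f (x + s *\<^sub>R w) - f x) =
      s * (g (x + p *\<^sub>R v + s *\<^sub>R w) - g (x + p *\<^sub>R v))"
    by auto
  from MVT2[OF s dg[of p]] p obtain q where q: "0 < q" "q < s"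
    "g (x + p *\<^sub>R v + s *\<^sub>R w) - g (x + p *\<^sub>R v) =
      s * frechet_derivative g (at (x + p *\<^sub>R v + q *\<^sub>R w)) w"
    by auto
  show thesis
    using p q by (intro that[of p q]) (auto simp: g_def power2_eq_square algebra_simps)
qed

text \<open>The second difference is symmetric in \<open>v\<close> and \<open>w\<close>, so the two
  mixed derivatives take a common value at two points arbitrarily close to \<open>x\<close>;
  continuity carries the equality to \<open>x\<close>.\<close>

lemma frechet_derivative_commute:
  fixes f :: "'a::real_normed_vector \<Rightarrow> real"
  assumes "open S" "Ck_on 2 S f" "x \<in> S"
  shows "frechet_derivative (\<lambda>y. frechet_derivative f (at y) v) (at x) w =
    frechet_derivative (\<lambda>y. frechet_derivative f (at y) w) (at x) v"
proof -
  define A where "A = (\<lambda>v w y. frechet_derivative (\<lambda>y. frechet_derivative f (at y) v) (at y) w)"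
  have cont: "continuous_on S (A v w)" for v w
    using assms(2) by (simp add: A_def eval_nat_numeral)
  have "\<bar>A v w x - A w v x\<bar> < e" if "e > 0" for e
  proof -
    have "\<exists>d>0. \<forall>y. dist y x < d \<longrightarrow> y \<in> S \<and> dist (A v w y) (A v w x) < e / 2" for v w
    proof -
      have "open (S \<inter> A v w -` ball (A v w x) (e / 2))"
        using continuous_open_preimage[OF cont assms(1)] by blast
      moreover have "x \<in> S \<inter> A v w -` ball (A v w x) (e / 2)"
        using assms(3) that by simp
      ultimately obtain d where "d > 0" "ball x d \<subseteq> S \<inter> A v w -` ball (A v w x) (e / 2)"
        using open_contains_ball by meson
      then show ?thesis
        by (force simp: subset_iff dist_commute)
    qed
    from this[of v w] this[of w v] obtain d1 d2 where "d1 > 0" "d2 > 0"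
      and d1: "\<And>y. dist y x < d1 \<Longrightarrow> y \<in> S \<and> dist (A v w y) (A v w x) < e / 2"
      and d2: "\<And>y. dist y x < d2 \<Longrightarrow> y \<in> S \<and> dist (A w v y) (A w v x) < e / 2"
      by blast
    define d where "d = min d1 d2"
    \<comment> \<open>Chosen so that the parallelogram with sides \<open>s *\<^sub>R v\<close> and
      \<open>s *\<^sub>R w\<close> lies within distance \<open>d\<close> of \<open>x\<close>; the
      summand 1 keeps the quotient meaningful for \<open>v = w = 0\<close> and the estimate
      strict.\<close>
    define s where "s = d / (norm v + norm w + 1)"
    have "d > 0" using \<open>d1 > 0\<close> \<open>d2 > 0\<close> by (simp add: d_def)
    have npos: "norm v + norm w + 1 > 0" by (smt (verit) norm_ge_zero)
    have s: "s > 0" using \<open>d > 0\<close> npos by (simp add: s_def)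
    have small: "dist (x + p *\<^sub>R v + q *\<^sub>R w) x < d" if "0 \<le> p" "p \<le> s" "0 \<le> q" "q \<le> s" for p q
    proof -
      have "dist (x + p *\<^sub>R v + q *\<^sub>R w) x \<le> norm (p *\<^sub>R v) + norm (q *\<^sub>R w)"
        by (simp add: dist_norm add.assoc norm_triangle_ineq del: norm_scaleR)
      also have "\<dots> \<le> s * norm v + s * norm w"
        using that by (intro add_mono) (auto intro: mult_right_mono)
      also have "\<dots> < s * (norm v + norm w + 1)"
        using s by (simp add: algebra_simps)
      also have "\<dots> = d" using npos by (simp add: s_def)
      finally show ?thesis .
    qed
    obtain p q where pq: "0 \<le> p" "p \<le> s" "0 \<le> q" "q \<le> s"
      "f (x + s *\<^sub>R v + s *\<^sub>R w) - f (x + s *\<^sub>R v) - f (x + s *\<^sub>R w) + f x =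
       s\<^sup>2 * A v w (x + p *\<^sub>R v + q *\<^sub>R w)"
      unfolding A_def using small d1 d_def
      by (rule_tac second_difference_mean_value[OF assms(2) s, of x v w]) auto
    have small': "dist (x + p *\<^sub>R w + q *\<^sub>R v) x < d" if "0 \<le> p" "p \<le> s" "0 \<le> q" "q \<le> s" for p q
      using small[OF that(3,4,1,2)] by (simp add: algebra_simps)
    obtain p' q' where pq': "0 \<le> p'" "p' \<le> s" "0 \<le> q'" "q' \<le> s"
      "f (x + s *\<^sub>R w + s *\<^sub>R v) - f (x + s *\<^sub>R w) - f (x + s *\<^sub>R v) + f x =
       s\<^sup>2 * A w v (x + p' *\<^sub>R w + q' *\<^sub>R v)"
      unfolding A_def using small' d1 d_def
      by (rule_tac second_difference_mean_value[OF assms(2) s, of x w v]) auto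
    have "s\<^sup>2 * A v w (x + p *\<^sub>R v + q *\<^sub>R w) = s\<^sup>2 * A w v (x + p' *\<^sub>R w + q' *\<^sub>R v)"
      using pq(5) pq'(5) by (simp add: algebra_simps)
    then have "A v w (x + p *\<^sub>R v + q *\<^sub>R w) = A w v (x + p' *\<^sub>R w + q' *\<^sub>R v)"
      using s by simp
    moreover have "dist (A v w (x + p *\<^sub>R v + q *\<^sub>R w)) (A v w x) < e / 2"
      using d1 small[OF pq(1-4)] d_def by simp
    moreover have "dist (A w v (x + p' *\<^sub>R w + q' *\<^sub>R v)) (A w v x) < e / 2"
      using d2 small'[OF pq'(1-4)] d_def by simp
    ultimately show ?thesis
      by (simp only: dist_real_def)
  qed
  then have "A v w x = A w v x"
    by (metis abs_not_less_zero less_irrefl right_minus_eq zero_less_abs_iff)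
  then show ?thesis by (simp add: A_def)
qed

section \<open>Uniqueness of integral curves\<close>

text \<open>On a compact ball the derivatives in the finitely many basis directions are bounded, and
  the sum of the bounds dominates the operator norm. The mean value inequality on the convex open
  ball then gives the Lipschitz constant.\<close>

lemma Ck_on_locally_lipschitz:
  fixes X :: "'a::euclidean_space \<Rightarrow> 'b::real_normed_vector"
  assumes "open M" "Ck_on 1 M X" "m \<in> M"
  obtains r L where "r > 0" "ball m r \<subseteq> M" "L \<ge> 0"
    "\<And>x y. x \<in> ball m r \<Longrightarrow> y \<in> ball m r \<Longrightarrow> norm (X x - X y) \<le> L * norm (x - y)"
proof -
  obtain r where r: "r > 0" "cball m r \<subseteq> M"
    using assms(1,3) open_contains_cball by blast
  have "\<exists>B. \<forall>x\<in>cball m r. norm (frechet_derivative X (at x) b) \<le> B" for b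
  proof -
    have "continuous_on (cball m r) (\<lambda>x. frechet_derivative X (at x) b)"
      using assms(2) by (intro continuous_on_subset[OF _ r(2)]) simp
    then have "bounded ((\<lambda>x. frechet_derivative X (at x) b) ` cball m r)"
      by (intro compact_imp_bounded compact_continuous_image) auto
    then show ?thesis
      by (auto simp: bounded_iff)
  qed
  then obtain B where B: "\<And>b x. x \<in> cball m r \<Longrightarrow> norm (frechet_derivative X (at x) b) \<le> B b"
    by metis
  define L where "L = (\<Sum>b\<in>Basis. B b)"
  have B0: "B b \<ge> 0" for b
    using B[of m b] r(1) norm_ge_zero order_trans by (meson centre_in_cball less_imp_le)
  have der: "(X has_derivative frechet_derivative X (at x)) (at x)" if "x \<in> ball m r" for x
    using Ck_on_Suc_has_derivative[of 0 M X x] assms(2) that r(2) by (auto simp: subset_iff)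
  have "norm (frechet_derivative X (at x) v) \<le> L * norm v" if "x \<in> ball m r" for x v
  proof -
    have "norm (frechet_derivative X (at x) v) = norm (\<Sum>b\<in>Basis. (v \<bullet> b) *\<^sub>R frechet_derivative X (at x) b)"
      using linear_Basis_expansion has_derivative_linear[OF der[OF that]] by metis
    also have "\<dots> \<le> (\<Sum>b\<in>Basis. B b * norm v)"
    proof (rule sum_norm_le)
      fix b :: 'a assume "b \<in> Basis"
      then show "norm ((v \<bullet> b) *\<^sub>R frechet_derivative X (at x) b) \<le> B b * norm v"
        using B[of x b] that B0 Basis_le_norm[of b v]
        by (auto simp: mult.commute[of "B b"] intro!: mult_mono)
    qed
    finally show ?thesis by (simp add: L_def sum_distrib_right)
  qed
  then have "onorm (frechet_derivative X (at x)) \<le> L" if "x \<in> ball m r" for x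
    using that by (intro onorm_bound) (auto simp: L_def sum_nonneg B0)
  then have "norm (X x - X y) \<le> L * norm (x - y)" if "x \<in> ball m r" "y \<in> ball m r" for x y
    using differentiable_bound[of "ball m r" X "\<lambda>x. frechet_derivative X (at x)" L] that der
    by (simp add: has_derivative_at_withinI)
  moreover have "L \<ge> 0" by (simp add: L_def sum_nonneg B0)
  ultimately show thesis
    using that r ball_subset_cball by blast
qed

text \<open>\<open>\<bar>w\<bar>\<^sup>2\<close> grows at most like \<open>exp (2 L \<bar>s - s0\<bar>)\<close> away from \<open>s0\<close>, on either side.\<close>
lemma gronwall_zero:
  fixes w :: "real \<Rightarrow> 'a::real_inner"
  assumes der: "\<And>s. \<bar>s - s0\<bar> < d \<Longrightarrow> (w has_vector_derivative w' s) (at s)"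
    and bound: "\<And>s. \<bar>s - s0\<bar> < d \<Longrightarrow> norm (w' s) \<le> L * norm (w s)"
    and zero: "w s0 = 0" and s: "\<bar>s - s0\<bar> < d"
  shows "w s = 0"
proof -
  have D: "((\<lambda>s. exp (c * s) * (w s \<bullet> w s)) has_real_derivative
      exp (c * s) * (c * (w s \<bullet> w s) + 2 * (w s \<bullet> w' s))) (at s)" if "\<bar>s - s0\<bar> < d" for c s
  proof -
    have "((\<lambda>s. w s \<bullet> w s) has_real_derivative 2 * (w s \<bullet> w' s)) (at s)"
      using has_derivative_inner[OF der[OF that, unfolded has_vector_derivative_def]
          der[OF that, unfolded has_vector_derivative_def]]
      unfolding has_field_derivative_def
      by (rule back_subst[where P = "\<lambda>f. (_ has_derivative f) _"])
        (auto simp: fun_eq_iff inner_commute)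
    then show ?thesis
      by (auto intro!: derivative_eq_intros simp: algebra_simps)
  qed
  have est: "\<bar>2 * (w s \<bullet> w' s)\<bar> \<le> 2 * L * (w s \<bullet> w s)" if "\<bar>s - s0\<bar> < d" for s
  proof -
    have "\<bar>w s \<bullet> w' s\<bar> \<le> norm (w s) * norm (w' s)" by (rule Cauchy_Schwarz_ineq2)
    also have "\<dots> \<le> norm (w s) * (L * norm (w s))"
      using bound[OF that] by (intro mult_left_mono) auto
    finally show ?thesis
      by (simp add: dot_square_norm power2_eq_square mult_ac)
  qed
  \<comment> \<open>The sign of \<open>c\<close> depends on the side: to the right of
    \<open>s0\<close> the weighted square decreases, to the left it increases towards
    \<open>s0\<close>. Either way it is bounded by its value at \<open>s0\<close>, which is
    0.\<close>
  have "exp (c * s) * (w s \<bullet> w s) \<le> 0" if "c = (if s0 \<le> s then - 2 * L else 2 * L)" for c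
  proof (cases "s0 \<le> s")
    case True
    have "exp (c * s) * (w s \<bullet> w s) \<le> exp (c * s0) * (w s0 \<bullet> w s0)"
    proof (rule DERIV_nonpos_imp_nonincreasing[OF True])
      fix r assume "s0 \<le> r" "r \<le> s"
      then have r: "\<bar>r - s0\<bar> < d" using s by auto
      have "c * (w r \<bullet> w r) + 2 * (w r \<bullet> w' r) \<le> 0"
        using est[OF r] that True by auto
      then show "\<exists>y. ((\<lambda>s. exp (c * s) * (w s \<bullet> w s)) has_real_derivative y) (at r) \<and> y \<le> 0"
        using D[OF r, of c] by (intro exI[of _ "exp (c * r) * (c * (w r \<bullet> w r) + 2 * (w r \<bullet> w' r))"])
          (auto simp: mult_le_0_iff)
    qed
    then show ?thesis using zero by simp
  next
    case False
    have "exp (c * s) * (w s \<bullet> w s) \<le> exp (c * s0) * (w s0 \<bullet> w s0)"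
    proof (rule DERIV_nonneg_imp_nondecreasing[where a = s and b = s0 and f = "\<lambda>s. exp (c * s) * (w s \<bullet> w s)"])
      show "s \<le> s0" using False by simp
      fix r assume "s \<le> r" "r \<le> s0"
      then have r: "\<bar>r - s0\<bar> < d" using s by auto
      have "c * (w r \<bullet> w r) + 2 * (w r \<bullet> w' r) \<ge> 0"
        using est[OF r] that False by auto
      then show "\<exists>y. ((\<lambda>s. exp (c * s) * (w s \<bullet> w s)) has_real_derivative y) (at r) \<and> y \<ge> 0"
        using D[OF r, of c] by (intro exI[of _ "exp (c * r) * (c * (w r \<bullet> w r) + 2 * (w r \<bullet> w' r))"])
          auto
    qed
    then show ?thesis using zero by simp
  qed
  then show ?thesis
    by (metis exp_gt_zero inner_eq_zero_iff inner_ge_zero mult_le_0_iff order_antisym not_less)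
qed

text \<open>For a short time both curves stay in one ball on which \<open>X\<close> is Lipschitz, so
  their difference satisfies the differential inequality of \<open>gronwall_zero\<close>.\<close>

lemma integral_curve_local_unique:
  fixes X :: "'a::euclidean_space \<Rightarrow> 'a"
  assumes "open M" "Ck_on 1 M X" "integral_curve X M I \<gamma>" "integral_curve X M J \<eta>"
    and "s0 \<in> I" "s0 \<in> J" "\<gamma> s0 = \<eta> s0"
  shows "\<exists>d>0. \<forall>s. \<bar>s - s0\<bar> < d \<longrightarrow> s \<in> I \<and> s \<in> J \<and> \<gamma> s = \<eta> s"
proof -
  have \<gamma>: "\<gamma> s \<in> M" "(\<gamma> has_vector_derivative X (\<gamma> s)) (at s)" if "s \<in> I" for s
    using assms(3) that by (auto simp: integral_curve_def)
  have \<eta>: "\<eta> s \<in> M" "(\<eta> has_vector_derivative X (\<eta> s)) (at s)" if "s \<in> J" for s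
    using assms(4) that by (auto simp: integral_curve_def)
  obtain r L where r: "r > 0" and lip: "\<And>x y. x \<in> ball (\<gamma> s0) r \<Longrightarrow> y \<in> ball (\<gamma> s0) r \<Longrightarrow>
      norm (X x - X y) \<le> L * norm (x - y)"
    using Ck_on_locally_lipschitz[OF assms(1,2) \<gamma>(1)[OF assms(5)]] by metis
  have IJ: "open I" "open J"
    using assms(3,4) by (auto simp: integral_curve_def)
  have "continuous_on I \<gamma>" "continuous_on J \<eta>"
    using \<gamma>(2) \<eta>(2) by (auto intro!: continuous_at_imp_continuous_on has_vector_derivative_continuous)
  then have "open (I \<inter> \<gamma> -` ball (\<gamma> s0) r)" "open (J \<inter> \<eta> -` ball (\<gamma> s0) r)"
    using IJ by (auto intro: continuous_open_preimage)
  then have "open ((I \<inter> \<gamma> -` ball (\<gamma> s0) r) \<inter> (J \<inter> \<eta> -` ball (\<gamma> s0) r))" (is "open ?V")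
    by blast
  moreover have "s0 \<in> ?V" using assms(5-7) r by auto
  ultimately obtain d where d: "d > 0" "ball s0 d \<subseteq> ?V"
    using open_contains_ball by meson
  have V: "s \<in> I" "s \<in> J" "\<gamma> s \<in> ball (\<gamma> s0) r" "\<eta> s \<in> ball (\<gamma> s0) r" if "\<bar>s - s0\<bar> < d" for s
    using d(2) that by (auto simp: subset_iff dist_real_def abs_minus_commute)
  have "\<gamma> s - \<eta> s = 0" if "\<bar>s - s0\<bar> < d" for s
  proof (rule gronwall_zero[OF _ _ _ that, where w' = "\<lambda>s. X (\<gamma> s) - X (\<eta> s)" and L = L])
    show "((\<lambda>s. \<gamma> s - \<eta> s) has_vector_derivative X (\<gamma> s) - X (\<eta> s)) (at s)" if "\<bar>s - s0\<bar> < d" for s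
      using V that \<gamma>(2) \<eta>(2) by (blast intro: has_vector_derivative_diff)
  qed (use V lip assms(7) in auto)
  then show ?thesis using d(1) V by auto
qed

text \<open>The coincidence set is open by local uniqueness and relatively closed by continuity,
  hence all of the connected set \<open>I \<inter> J\<close> as soon as it contains one
  time.\<close>

lemma integral_curve_unique:
  fixes X :: "'a::euclidean_space \<Rightarrow> 'a"
  assumes "open M" "Ck_on 1 M X" "integral_curve X M I \<gamma>" "integral_curve X M J \<eta>"
    and "s \<in> I \<inter> J" "t \<in> I \<inter> J" "\<gamma> s = \<eta> s"
  shows "\<gamma> t = \<eta> t"
proof -
  define E where "E = {s \<in> I \<inter> J. \<gamma> s = \<eta> s}"
  have "connected (I \<inter> J)"
    using assms(3,4) is_interval_Int is_interval_connected by (auto simp: integral_curve_def)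
  moreover have "open E"
    unfolding open_contains_ball
  proof
    fix s0 assume "s0 \<in> E"
    then obtain d where "d > 0" "\<forall>s. \<bar>s - s0\<bar> < d \<longrightarrow> s \<in> I \<and> s \<in> J \<and> \<gamma> s = \<eta> s"
      using integral_curve_local_unique[OF assms(1-4)] by (auto simp: E_def)
    then show "\<exists>e>0. ball s0 e \<subseteq> E"
      by (intro exI[of _ d]) (auto simp: E_def dist_real_def abs_minus_commute)
  qed
  then have "openin (top_of_set (I \<inter> J)) E"
    by (intro open_subset) (auto simp: E_def)
  moreover have "closedin (top_of_set (I \<inter> J)) E"
  proof -
    have "continuous_on (I \<inter> J) (\<lambda>s. \<gamma> s - \<eta> s)"
      using assms(3,4) unfolding integral_curve_def
      by (auto intro!: continuous_intros continuous_at_imp_continuous_on intro: has_vector_derivative_continuous)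
    from continuous_closedin_preimage_constant[OF this, of 0] show ?thesis
      by (simp add: E_def)
  qed
  ultimately have "E = {} \<or> E = I \<inter> J"
    using connected_clopen by blast
  then show ?thesis
    using assms(5-7) by (auto simp: E_def)
qed

text \<open>Uniqueness makes the definite description in \<open>flow\<close> well defined, so any
  single integral curve evaluates it.\<close>

lemma flow_eq:
  fixes X :: "'a::euclidean_space \<Rightarrow> 'a"
  assumes "open M" "Ck_on 1 M X" "integral_curve X M I \<gamma>" "0 \<in> I" "t \<in> I"
  shows "flow X M t (\<gamma> 0) = \<gamma> t"
  unfolding flow_def
proof (rule the_equality)
  fix y assume "\<exists>J \<eta>. integral_curve X M J \<eta> \<and> 0 \<in> J \<and> t \<in> J \<and> \<eta> 0 = \<gamma> 0 \<and> \<eta> t = y"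
  then obtain J \<eta> where "integral_curve X M J \<eta>" "0 \<in> J" "t \<in> J" "\<eta> 0 = \<gamma> 0" "\<eta> t = y"
    by blast
  then show "y = \<gamma> t"
    using integral_curve_unique[OF assms(1-3), of J \<eta> 0 t] assms(4,5) by auto
qed (use assms in blast)

text \<open>The projected curve is an integral curve downstairs, hence by uniqueness it computes the
  flow there.\<close>
lemma flow_lift_bounded_linear:
  fixes X :: "'b::euclidean_space \<Rightarrow> 'b" and Y :: "'a::euclidean_space \<Rightarrow> 'a"
  assumes "open N" "open M" "Ck_on 1 N X" "Ck_on 1 M Y" "bounded_linear pr" "pr ` N \<subseteq> M"
    and related: "\<And>u. u \<in> N \<Longrightarrow> pr (X u) = Y (pr u)"
  shows "flow_lift pr X N Y M"
  unfolding flow_lift_def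
proof (intro conjI allI impI)
  fix t u assume "(t, u) \<in> flow_dom X N"
  then obtain I \<gamma> where \<gamma>: "integral_curve X N I \<gamma>" "0 \<in> I" "t \<in> I" "\<gamma> 0 = u"
    by (auto simp: flow_dom_def)
  have pr: "integral_curve Y M I (\<lambda>t. pr (\<gamma> t))"
    using \<gamma>(1) assms(6) related bounded_linear.has_vector_derivative[OF assms(5)]
    unfolding integral_curve_def by fastforce
  then show "(t, pr u) \<in> flow_dom Y M"
    using \<gamma> unfolding flow_dom_def by blast
  show "flow Y M t (pr u) = pr (flow X N t u)"
    using flow_eq[OF assms(1,3) \<gamma>(1-3)] flow_eq[OF assms(2,4) pr \<gamma>(2,3)] \<gamma>(4) by simp
qed (fact assms(6))

section \<open>Derivatives in canonical coordinates\<close>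

lemma frechet_derivative_pderiv_vec_sum:
  assumes "f differentiable at x"
  shows "frechet_derivative f (at x) v = (\<Sum>a\<in>UNIV. v $ a * pderiv_vec f a x)"
proof -
  have lin: "linear (frechet_derivative f (at x))"
    using assms by (rule linear_frechet_derivative)
  have "v = (\<Sum>a\<in>UNIV. v $ a *\<^sub>R axis a 1)"
    by (simp add: vec_eq_iff axis_def if_distrib cong: if_cong)
  then have "frechet_derivative f (at x) v = frechet_derivative f (at x) (\<Sum>a\<in>UNIV. v $ a *\<^sub>R axis a 1)"
    by (rule arg_cong)
  also have "\<dots> = (\<Sum>a\<in>UNIV. v $ a * pderiv_vec f a x)"
    using lin by (simp add: linear_sum linear_scale pderiv_vec_def)
  finally show ?thesis .
qed

lemma smooth_on_pderiv_vec: "smooth_on S f \<Longrightarrow> smooth_on S (pderiv_vec f a)"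
  unfolding pderiv_vec_def by (rule smooth_on_frechet_derivative)

text \<open>Both sides are the Hessian of \<open>f\<close> on the pair \<open>v\<close>,
  \<open>w\<close>: contracting the partials with a constant vector gives a directional derivative,
  to which the commutation of second derivatives applies.\<close>

lemma pderiv_vec_symmetric_form:
  assumes "open S" "smooth_on S f" "x \<in> S"
  shows "(\<Sum>a\<in>UNIV. v $ a * frechet_derivative (pderiv_vec f a) (at x) w) =
    (\<Sum>a\<in>UNIV. w $ a * frechet_derivative (pderiv_vec f a) (at x) v)"
proof -
  have "(\<Sum>a\<in>UNIV. v $ a * frechet_derivative (pderiv_vec f a) (at x) w) =
    frechet_derivative (\<lambda>y. frechet_derivative f (at y) v) (at x) w" for v w
  proof -
    have "((\<lambda>y. \<Sum>a\<in>UNIV. v $ a * pderiv_vec f a y) has_derivative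
        (\<lambda>w. \<Sum>a\<in>UNIV. v $ a * frechet_derivative (pderiv_vec f a) (at x) w)) (at x)"
      using smooth_on_has_derivative[OF smooth_on_pderiv_vec[OF assms(2)] assms(3)]
      by (intro has_derivative_sum has_derivative_mult_right)
    then have "((\<lambda>y. frechet_derivative f (at y) v) has_derivative
        (\<lambda>w. \<Sum>a\<in>UNIV. v $ a * frechet_derivative (pderiv_vec f a) (at x) w)) (at x)"
      by (rule has_derivative_transform_within_open[OF _ assms(1,3)])
        (simp add: frechet_derivative_pderiv_vec_sum smooth_on_differentiable[OF assms(2)])
    from frechet_derivative_at[OF this, symmetric] show ?thesis
      by simp
  qed
  then show ?thesis
    using frechet_derivative_commute[OF assms(1) smooth_onD[OF assms(2)] assms(3)] by simp
qed

lemma pderiv_vec_nth_sum: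
  assumes "F differentiable at x"
  shows "frechet_derivative F (at x) v $ b = (\<Sum>a\<in>UNIV. v $ a * pderiv_vec (\<lambda>x. F x $ b) a x)"
proof -
  have D: "((\<lambda>x. F x $ b) has_derivative (\<lambda>v. frechet_derivative F (at x) v $ b)) (at x)"
    using assms by (intro bounded_linear.has_derivative[OF bounded_linear_vec_nth])
      (simp flip: frechet_derivative_works)
  show ?thesis
    using frechet_derivative_pderiv_vec_sum[OF differentiableI[OF D], of v]
    by (simp flip: frechet_derivative_at[OF D])
qed

section \<open>Differentials of the coordinate functions and of the contact form\<close>

lemma proj_x_eq_fst: "proj_x = fst"
  by (auto simp: proj_x_def fun_eq_iff)

lemma has_derivative_Delta0:
  assumes "(\<psi> has_derivative \<psi>') (at (fst u))"
  shows "(Delta0 \<psi> has_derivative (\<lambda>w. \<psi>' (fst w) - snd (snd w))) (at u)"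
proof -
  have "((\<lambda>u. \<psi> (fst u)) has_derivative (\<lambda>w. \<psi>' (fst w))) (at u)"
    using has_derivative_compose[OF has_derivative_fst[OF has_derivative_ident] assms] .
  then show ?thesis
    unfolding Delta0_def case_prod_beta by (auto intro!: derivative_intros)
qed

lemma has_derivative_Delta:
  assumes "(pderiv_vec \<psi> a has_derivative P) (at (fst u))"
  shows "(Delta \<psi> a has_derivative (\<lambda>w. P (fst w) - fst (snd w) $ a)) (at u)"
proof -
  have "((\<lambda>u. pderiv_vec \<psi> a (fst u)) has_derivative (\<lambda>w. P (fst w))) (at u)"
    using has_derivative_compose[OF has_derivative_fst[OF has_derivative_ident] assms] .
  then show ?thesis
    unfolding Delta_def case_prod_beta
    by (intro has_derivative_diff bounded_linear.has_derivative[OF bounded_linear_vec_nth]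
        has_derivative_fst has_derivative_snd has_derivative_ident)
qed

text \<open>This is the coordinate formula that d\<lambda> is the sum of the forms dx^a wedge dp_a.
  With the vector argument held constant, the contact form is affine in the base point, so its
  derivative is read off.\<close>

lemma ext_deriv_contact_form:
  "ext_deriv contact_form u v w = fst v \<bullet> fst (snd w) - fst (snd v) \<bullet> fst w"
proof -
  have "((\<lambda>m. contact_form m w) has_derivative (\<lambda>h. - (fst (snd h) \<bullet> fst w))) (at u)" for w
  proof -
    have "(\<lambda>m. contact_form m w) = (\<lambda>m. snd (snd w) - fst (snd m) \<bullet> fst w)"
      by (auto simp: contact_form_def inner_vec_def fun_eq_iff split: prod.splits)
    then show ?thesis by (auto intro!: derivative_eq_intros)
  qed
  from frechet_derivative_at[OF this, symmetric] show ?thesis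
    by (simp add: ext_deriv_def inner_commute)
qed

text \<open>The contact form is non-degenerate: \<open>d\<lambda>\<close> recovers the \<open>x\<close> and \<open>p\<close> components of a vector,
  and then \<open>\<lambda>\<close> its \<open>z\<close> component.\<close>
lemma contact_hamiltonian_vf_unique:
  assumes "contact_hamiltonian_vf C h X" "contact_hamiltonian_vf C h Y" "u \<in> C"
  shows "Y u = X u"
proof -
  have eq: "fst (Y u) \<bullet> fst (snd w) - fst (snd (Y u)) \<bullet> fst w =
      fst (X u) \<bullet> fst (snd w) - fst (snd (X u)) \<bullet> fst w" for w
    using assms unfolding contact_hamiltonian_vf_def ext_deriv_contact_form by simp
  have x: "fst (Y u) = fst (X u)"
    using eq[of "(0, v, 0)" for v] vector_eq_rdot[of "fst (Y u)" "fst (X u)"] by simp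
  moreover have "fst (snd (Y u)) = fst (snd (X u))"
    using eq[of "(v, 0, 0)" for v] vector_eq_rdot[of "fst (snd (Y u))" "fst (snd (X u))"] by simp
  moreover have "contact_form u (Y u) = contact_form u (X u)"
    using assms unfolding contact_hamiltonian_vf_def by simp
  then have "snd (snd (Y u)) = snd (snd (X u))"
    using x by (simp add: contact_form_def split: prod.splits)
  ultimately show ?thesis by (simp add: prod_eq_iff)
qed

text \<open>Chain rule along a trajectory; it turns identities for \<open>lie\<close> into genuine
  time derivatives.\<close>

lemma integral_curve_has_real_derivative:
  fixes f :: "'a::real_normed_vector \<Rightarrow> real"
  assumes "integral_curve X M I \<gamma>" "t \<in> I" "f differentiable at (\<gamma> t)"
  shows "((\<lambda>t. f (\<gamma> t)) has_real_derivative lie X f (\<gamma> t)) (at t)"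
proof -
  have "(\<gamma> has_derivative (\<lambda>h. h *\<^sub>R X (\<gamma> t))) (at t)"
    using assms(1,2) by (auto simp: integral_curve_def has_vector_derivative_def)
  then have "((\<lambda>t. f (\<gamma> t)) has_derivative (\<lambda>h. frechet_derivative f (at (\<gamma> t)) (h *\<^sub>R X (\<gamma> t)))) (at t)"
    using assms(3)[unfolded frechet_derivative_works] by (rule has_derivative_compose)
  then show ?thesis
    using linear_scale[OF linear_frechet_derivative[OF assms(3)]]
    by (simp add: has_field_derivative_def lie_def mult_commute_abs)
qed

section \<open>The lifted vector field\<close>

text \<open>The solution of the lift equations obtained by differentiating p_a = \<partial>_a \<psi>
  - \<Delta>_a and z = \<psi> - \<Delta>_0 along the flow. The first summand of the \<open>p\<close>
  component is the Hessian of \<psi> contracted with \<open>F\<close>.\<close>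

definition lift_vf :: "((real^'n::finite) \<Rightarrow> real) \<Rightarrow> (real^'n \<Rightarrow> real^'n) \<Rightarrow> (real \<Rightarrow> real) \<Rightarrow>
    'n contact_pt \<Rightarrow> 'n contact_pt" where
  "lift_vf \<psi> F \<Gamma> u =
    (F (fst u),
     \<chi> a. frechet_derivative (pderiv_vec \<psi> a) (at (fst u)) (F (fst u)) +
       (\<Sum>b\<in>UNIV. pderiv_vec (\<lambda>x. F x $ b) a (fst u) * Delta \<psi> b u) +
       deriv \<Gamma> (Delta0 \<psi> u) * Delta \<psi> a u,
     frechet_derivative \<psi> (at (fst u)) (F (fst u)) + \<Gamma> (Delta0 \<psi> u))"

lemma lie_fst: "lie X (\<lambda>u. fst u $ a) u = fst (X u) $ a"
  using fun_cong[OF frechet_derivative_at[OF bounded_linear_imp_has_derivative[OF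
      bounded_linear_compose[OF bounded_linear_vec_nth bounded_linear_fst]], of a u], of "X u"]
  by (simp add: lie_def)

lemma lie_Delta:
  assumes "pderiv_vec \<psi> a differentiable at (fst u)"
  shows "lie X (Delta \<psi> a) u =
    frechet_derivative (pderiv_vec \<psi> a) (at (fst u)) (fst (X u)) - fst (snd (X u)) $ a"
  using fun_cong[OF frechet_derivative_at[OF has_derivative_Delta[OF
      assms[unfolded frechet_derivative_works]]], of "X u"]
  by (simp add: lie_def)

lemma lie_Delta0:
  assumes "\<psi> differentiable at (fst u)"
  shows "lie X (Delta0 \<psi>) u = frechet_derivative \<psi> (at (fst u)) (fst (X u)) - snd (snd (X u))"
  using fun_cong[OF frechet_derivative_at[OF has_derivative_Delta0[OF
      assms[unfolded frechet_derivative_works]]], of "X u"]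
  by (simp add: lie_def)

text \<open>Once the \<open>x\<close> component is known, each remaining equation contains exactly
  one unknown component, with coefficient -1. Existence and uniqueness of the lift on
  \<open>C\<close> come out of this equivalence together.\<close>

lemma lift_equations_iff:
  assumes "smooth_on U \<psi>" "proj_x ` C \<subseteq> U"
  shows "lift_equations C \<psi> F \<Gamma> X \<longleftrightarrow> (\<forall>u\<in>C. X u = lift_vf \<psi> F \<Gamma> u)"
  unfolding lift_equations_def proj_x_eq_fst lie_fst
proof (rule ball_cong[OF refl])
  fix u assume "u \<in> C"
  then have "fst u \<in> U" using assms(2) by (auto simp: proj_x_eq_fst)
  then have D: "lie X (Delta \<psi> a) u =
      frechet_derivative (pderiv_vec \<psi> a) (at (fst u)) (fst (X u)) - fst (snd (X u)) $ a"
    and D0: "lie X (Delta0 \<psi>) u = frechet_derivative \<psi> (at (fst u)) (fst (X u)) - snd (snd (X u))" for a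
    using smooth_on_differentiable[OF assms(1)] smooth_on_differentiable[OF smooth_on_pderiv_vec[OF assms(1)]]
    by (blast intro: lie_Delta lie_Delta0)+
  show "((\<forall>a. fst (X u) $ a = F (fst u) $ a) \<and>
      (\<forall>a. lie X (Delta \<psi> a) u =
        - (\<Sum>b\<in>UNIV. pderiv_vec (\<lambda>x. F x $ b) a (fst u) * Delta \<psi> b u)
        - deriv \<Gamma> (Delta0 \<psi> u) * Delta \<psi> a u) \<and>
      lie X (Delta0 \<psi>) u = - \<Gamma> (Delta0 \<psi> u)) \<longleftrightarrow> X u = lift_vf \<psi> F \<Gamma> u"
  \<comment> \<open>If the \<open>x\<close> component is not \<open>F\<close>, both sides are false;
    otherwise it may be substituted in the other equations.\<close>
  proof (cases "fst (X u) = F (fst u)")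
    case True
    have "fst (snd (X u)) = fst (snd (lift_vf \<psi> F \<Gamma> u)) \<longleftrightarrow> (\<forall>a. lie X (Delta \<psi> a) u =
        - (\<Sum>b\<in>UNIV. pderiv_vec (\<lambda>x. F x $ b) a (fst u) * Delta \<psi> b u)
        - deriv \<Gamma> (Delta0 \<psi> u) * Delta \<psi> a u)"
      unfolding vec_eq_iff D True
      by (intro iff_allI) (auto simp: lift_vf_def)
    moreover have "snd (snd (X u)) = snd (snd (lift_vf \<psi> F \<Gamma> u)) \<longleftrightarrow>
        lie X (Delta0 \<psi>) u = - \<Gamma> (Delta0 \<psi> u)"
      unfolding D0 True by (auto simp: lift_vf_def)
    moreover have "fst (lift_vf \<psi> F \<Gamma> u) = F (fst u)"
      by (simp add: lift_vf_def)
    ultimately show ?thesis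
      using True by (simp only: prod_eq_iff[of "X u"] prod_eq_iff[of "snd (X u)"]) simp
  next
    case False
    then show ?thesis by (auto simp: lift_vf_def vec_eq_iff)
  qed
qed

text \<open>Every ingredient is a smooth function of \<open>x\<close> pulled back along the
  projection, a smooth function of \<Delta>_0, or some \<Delta>_a; sums and products do the
  rest.\<close>

lemma smooth_on_lift_vf:
  assumes "open U" "open C" "proj_x ` C \<subseteq> U"
    and "smooth_on U \<psi>" "smooth_on U F" "smooth_on UNIV \<Gamma>"
  shows "smooth_on C (lift_vf \<psi> F \<Gamma>)"
  unfolding smooth_on_def
proof
  fix k
  note psi = smooth_onD[OF assms(4)] and F = smooth_onD[OF assms(5)] and G = smooth_onD[OF assms(6)]
  have base: "Ck_on k C (\<lambda>u. f (fst u))" if "Ck_on k U f" for f :: "real^'a \<Rightarrow> 'c::real_normed_vector"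
    using Ck_on_compose[OF assms(2,1) _ that bounded_linear_Ck_on[OF assms(2) bounded_linear_fst]]
      assms(3) by (simp add: proj_x_eq_fst)
  have D0: "Ck_on k C (Delta0 \<psi>)"
    unfolding Delta0_def case_prod_beta
    by (rule Ck_on_diff[OF assms(2) base[OF psi] bounded_linear_Ck_on[OF assms(2)
          bounded_linear_compose[OF bounded_linear_snd bounded_linear_snd]]])
  have D: "Ck_on k C (Delta \<psi> a)" for a
    unfolding Delta_def case_prod_beta
    by (rule Ck_on_diff[OF assms(2) base[OF smooth_onD[OF smooth_on_pderiv_vec[OF assms(4)]]]
          bounded_linear_Ck_on[OF assms(2) bounded_linear_compose[OF bounded_linear_vec_nth
            bounded_linear_compose[OF bounded_linear_fst bounded_linear_snd]]]])
  have G0: "Ck_on k C (\<lambda>u. g (Delta0 \<psi> u))" if "Ck_on k UNIV g" for g :: "real \<Rightarrow> real"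
    using Ck_on_compose[OF assms(2) open_UNIV _ that D0] by simp
  \<comment> \<open>Rewrites the one-variable derivative as the directional derivative in direction
    1, the form in which \<open>smooth_on\<close> passes to derivatives.\<close>
  have "deriv \<Gamma> = (\<lambda>s. frechet_derivative \<Gamma> (at s) 1)"
  proof
    fix s
    have lin: "linear (frechet_derivative \<Gamma> (at s))"
      using smooth_on_differentiable[OF assms(6)] by (intro linear_frechet_derivative) simp
    have eq: "frechet_derivative \<Gamma> (at s) = (*) (frechet_derivative \<Gamma> (at s) 1)"
    proof
      fix c
      show "frechet_derivative \<Gamma> (at s) c = frechet_derivative \<Gamma> (at s) 1 * c"
        using linear_scale[OF lin, of c 1] by (simp only: real_scaleR_def mult_1_right mult_1_left mult.commute)
    qed
    have "(\<Gamma> has_real_derivative frechet_derivative \<Gamma> (at s) 1) (at s)"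
      unfolding has_field_derivative_def
      by (rule back_subst[where P = "\<lambda>f'. (\<Gamma> has_derivative f') (at s)", OF smooth_on_has_derivative[OF assms(6) UNIV_I] eq])
    then show "deriv \<Gamma> s = frechet_derivative \<Gamma> (at s) 1"
      by (rule DERIV_imp_deriv)
  qed
  then have dG: "Ck_on k UNIV (deriv \<Gamma>)"
    using smooth_onD[OF smooth_on_frechet_derivative[OF assms(6)]] by simp
  have dF: "Ck_on k U (pderiv_vec (\<lambda>x. F x $ b) a)" for a b
    by (intro smooth_onD[OF smooth_on_pderiv_vec])
      (simp add: smooth_on_def Ck_on_bounded_linear[OF assms(1) bounded_linear_vec_nth F])
  have along: "Ck_on k U (\<lambda>x. frechet_derivative f (at x) (F x))" if "smooth_on U f" for f :: "real^'a \<Rightarrow> real"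
    by (rule Ck_on_frechet_derivative[OF assms(1) smooth_onD[OF that] F])
  have "Ck_on k C (\<lambda>u. \<chi> a. frechet_derivative (pderiv_vec \<psi> a) (at (fst u)) (F (fst u)) +
       (\<Sum>b\<in>UNIV. pderiv_vec (\<lambda>x. F x $ b) a (fst u) * Delta \<psi> b u) +
       deriv \<Gamma> (Delta0 \<psi> u) * Delta \<psi> a u)"
    by (intro Ck_on_vec_lambda Ck_on_add Ck_on_sum Ck_on_mult assms(2) D
        base[OF dF] base[OF along[OF smooth_on_pderiv_vec[OF assms(4)]]] G0[OF dG])
  moreover have "Ck_on k C (\<lambda>u. frechet_derivative \<psi> (at (fst u)) (F (fst u)) + \<Gamma> (Delta0 \<psi> u))"
    by (intro Ck_on_add assms(2) base[OF along[OF assms(4)]] G0[OF G])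
  ultimately show "Ck_on k C (lift_vf \<psi> F \<Gamma>)"
    unfolding lift_vf_def by (intro Ck_on_Pair assms(2) base[OF F])
qed

text \<open>The first condition is a regrouping, since \<Delta>_a F^a is the derivative of \<psi>
  along \<open>F\<close> minus p_a F^a. The second is checked on an arbitrary vector
  \<open>w\<close> after computing dh.\<close>

lemma contact_hamiltonian_lift_vf:
  assumes "open U" "proj_x ` C \<subseteq> U"
    and "smooth_on U \<psi>" "smooth_on U F" "smooth_on UNIV \<Gamma>"
  shows "contact_hamiltonian_vf C (lift_hamiltonian \<psi> F \<Gamma>) (lift_vf \<psi> F \<Gamma>)"
  unfolding contact_hamiltonian_vf_def
proof (intro ballI conjI allI)
  fix u assume u: "u \<in> C"
  define x p where "x = fst u" and "p = fst (snd u)"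
  have x: "x \<in> U" using u assms(2) by (auto simp: x_def proj_x_eq_fst)
  have d\<psi>: "frechet_derivative \<psi> (at x) w = (\<Sum>a\<in>UNIV. w $ a * pderiv_vec \<psi> a x)" for w
    using frechet_derivative_pderiv_vec_sum smooth_on_differentiable[OF assms(3) x] by blast
  have Delta: "Delta \<psi> a u = pderiv_vec \<psi> a x - p $ a" for a
    by (simp add: Delta_def x_def p_def case_prod_beta)
  show "contact_form u (lift_vf \<psi> F \<Gamma> u) = lift_hamiltonian \<psi> F \<Gamma> u"
    by (simp add: contact_form_def case_prod_beta lift_vf_def lift_hamiltonian_def proj_x_eq_fst
        d\<psi>[unfolded x_def] Delta x_def p_def algebra_simps sum_subtractf)
  fix w :: "'a contact_pt"
  \<comment> \<open>\<open>dD a\<close>, \<open>d0\<close> and \<open>dh\<close> are the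
    differentials at \<open>u\<close> of \<Delta>_a, \<Delta>_0 and the Hamiltonian.\<close>
  define dD where "dD = (\<lambda>a (w::'a contact_pt). frechet_derivative (pderiv_vec \<psi> a) (at x) (fst w) - fst (snd w) $ a)"
  define d0 where "d0 = (\<lambda>w::'a contact_pt. frechet_derivative \<psi> (at x) (fst w) - snd (snd w))"
  define dh where "dh = (\<lambda>w::'a contact_pt. (\<Sum>a\<in>UNIV. Delta \<psi> a u * frechet_derivative F (at x) (fst w) $ a + dD a w * F x $ a)
      + deriv \<Gamma> (Delta0 \<psi> u) * d0 w)"
  have D: "(Delta \<psi> a has_derivative dD a) (at u)" for a
    using has_derivative_Delta[OF smooth_on_has_derivative[OF smooth_on_pderiv_vec[OF assms(3)] x[unfolded x_def]]]
    by (simp add: dD_def x_def)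
  have D0: "(Delta0 \<psi> has_derivative d0) (at u)"
    using has_derivative_Delta0[OF smooth_on_has_derivative[OF assms(3) x[unfolded x_def]]]
    by (simp add: d0_def x_def)
  have dF: "((\<lambda>u. F (proj_x u) $ a) has_derivative (\<lambda>w. frechet_derivative F (at x) (fst w) $ a)) (at u)" for a
    using bounded_linear.has_derivative[OF bounded_linear_vec_nth has_derivative_compose[OF
          has_derivative_fst[OF has_derivative_ident] smooth_on_has_derivative[OF assms(4) x[unfolded x_def]]]]
    by (simp add: proj_x_eq_fst x_def)
  have dG: "(\<Gamma> has_real_derivative deriv \<Gamma> s) (at s)" for s
    using smooth_on_differentiable[OF assms(5), of s] DERIV_imp_deriv
    by (auto simp: real_differentiable_def)
  have "((\<lambda>u. (\<Sum>a\<in>UNIV. Delta \<psi> a u * F (proj_x u) $ a) + \<Gamma> (Delta0 \<psi> u)) has_derivative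
      (\<lambda>w. (\<Sum>a\<in>UNIV. Delta \<psi> a u * frechet_derivative F (at x) (fst w) $ a + dD a w * F (proj_x u) $ a)
        + deriv \<Gamma> (Delta0 \<psi> u) * d0 w)) (at u)"
    by (intro has_derivative_add has_derivative_sum has_derivative_mult D dF
        has_derivative_compose[OF D0 dG[unfolded has_field_derivative_def]])
  then have "(lift_hamiltonian \<psi> F \<Gamma> has_derivative dh) (at u)"
    by (simp add: lift_hamiltonian_def[abs_def] dh_def x_def proj_x_eq_fst)
  then have dh: "frechet_derivative (lift_hamiltonian \<psi> F \<Gamma>) (at u) = dh"
    by (rule frechet_derivative_at[symmetric])
  have F': "linear (frechet_derivative F (at x))" and \<psi>': "linear (frechet_derivative \<psi> (at x))"
    and P': "linear (frechet_derivative (pderiv_vec \<psi> a) (at x))" for a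
    by (intro linear_frechet_derivative smooth_on_differentiable[OF _ x] smooth_on_pderiv_vec assms(3,4))+
  \<comment> \<open>The Reeb field moves only \<open>z\<close>, which enters the Hamiltonian through
    \<Delta>_0 with slope -1.\<close>
  have R: "lie reeb (lift_hamiltonian \<psi> F \<Gamma>) u = - deriv \<Gamma> (Delta0 \<psi> u)"
    unfolding lie_def dh
    by (simp add: dh_def dD_def d0_def reeb_def linear_0[OF F'] linear_0[OF \<psi>'] linear_0[OF P'])
  have F'': "frechet_derivative F (at x) v $ b = (\<Sum>a\<in>UNIV. v $ a * pderiv_vec (\<lambda>x. F x $ b) a x)" for v b
    using pderiv_vec_nth_sum smooth_on_differentiable[OF assms(4) x] by blast
  have swap: "(\<Sum>b\<in>UNIV. Delta \<psi> b u * frechet_derivative F (at x) (fst w) $ b) =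
      (\<Sum>a\<in>UNIV. fst w $ a * (\<Sum>b\<in>UNIV. pderiv_vec (\<lambda>x. F x $ b) a x * Delta \<psi> b u))"
    unfolding F'' sum_distrib_left by (subst sum.swap) (simp add: mult_ac)
  \<comment> \<open>Symmetry of the Hessian of \<psi>: the field contracts it with \<open>F\<close>
    first, the differential of the Hamiltonian with \<open>w\<close> first.\<close>
  have sym: "(\<Sum>a\<in>UNIV. F x $ a * frechet_derivative (pderiv_vec \<psi> a) (at x) (fst w)) =
      (\<Sum>a\<in>UNIV. fst w $ a * frechet_derivative (pderiv_vec \<psi> a) (at x) (F x))"
    by (rule pderiv_vec_symmetric_form[OF assms(1,3) x])
  \<comment> \<open>The right-hand side is \<open>d0 w + contact_form u w\<close>; this is how the
    Reeb term in the contact equation gets absorbed.\<close>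
  have wDelta: "(\<Sum>a\<in>UNIV. fst w $ a * Delta \<psi> a u) = frechet_derivative \<psi> (at x) (fst w) - p \<bullet> fst w"
    by (simp add: d\<psi> Delta inner_vec_def algebra_simps sum_subtractf)
  have "fst (snd (lift_vf \<psi> F \<Gamma> u)) \<bullet> fst w =
      (\<Sum>a\<in>UNIV. fst w $ a * frechet_derivative (pderiv_vec \<psi> a) (at x) (F x)) +
      (\<Sum>a\<in>UNIV. fst w $ a * (\<Sum>b\<in>UNIV. pderiv_vec (\<lambda>x. F x $ b) a x * Delta \<psi> b u)) +
      deriv \<Gamma> (Delta0 \<psi> u) * (\<Sum>a\<in>UNIV. fst w $ a * Delta \<psi> a u)"
    by (simp add: lift_vf_def inner_vec_def x_def distrib_left distrib_right sum.distrib sum_distrib_left mult_ac)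
  also have "\<dots> = (\<Sum>a\<in>UNIV. Delta \<psi> a u * frechet_derivative F (at x) (fst w) $ a) +
      (\<Sum>a\<in>UNIV. F x $ a * frechet_derivative (pderiv_vec \<psi> a) (at x) (fst w)) +
      deriv \<Gamma> (Delta0 \<psi> u) * (frechet_derivative \<psi> (at x) (fst w) - p \<bullet> fst w)"
    unfolding swap sym wDelta by (simp only: add_ac)
  finally have P: "fst (snd (lift_vf \<psi> F \<Gamma> u)) \<bullet> fst w = \<dots>" .
  have cf: "contact_form u w = snd (snd w) - p \<bullet> fst w"
    by (simp add: contact_form_def case_prod_beta p_def inner_vec_def)
  have X: "fst (lift_vf \<psi> F \<Gamma> u) \<bullet> fst (snd w) = (\<Sum>a\<in>UNIV. F x $ a * fst (snd w) $ a)"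
    by (simp add: lift_vf_def x_def inner_vec_def)
  have dhw: "dh w = (\<Sum>a\<in>UNIV. Delta \<psi> a u * frechet_derivative F (at x) (fst w) $ a) +
      (\<Sum>a\<in>UNIV. F x $ a * frechet_derivative (pderiv_vec \<psi> a) (at x) (fst w)) -
      (\<Sum>a\<in>UNIV. F x $ a * fst (snd w) $ a) + deriv \<Gamma> (Delta0 \<psi> u) * d0 w"
    by (simp add: dh_def dD_def sum.distrib sum_subtractf algebra_simps)
  show "ext_deriv contact_form u (lift_vf \<psi> F \<Gamma> u) w =
      - (frechet_derivative (lift_hamiltonian \<psi> F \<Gamma>) (at u) w -
         lie reeb (lift_hamiltonian \<psi> F \<Gamma>) u * contact_form u w)"
    unfolding ext_deriv_contact_form X P dh R cf dhw by (simp add: d0_def algebra_simps)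
qed

section \<open>Restriction to the Legendre submanifold\<close>

text \<open>Vanishing of all \<Delta> functions determines \<open>p\<close> and \<open>z\<close> as
  gradient and value of \<psi> at \<open>x\<close>. The two inclusions between \<open>U\<close> and
  \<open>C\<close> match the domains.\<close>

lemma legendre_image_eq:
  assumes "proj_x ` C \<subseteq> U" "legendre_emb \<psi> ` U \<subseteq> C"
  shows "legendre_image C \<psi> = legendre_emb \<psi> ` U"
proof (intro equalityI subsetI)
  fix u assume u: "u \<in> legendre_image C \<psi>"
  then have "u = legendre_emb \<psi> (fst u)"
    by (cases u) (auto simp: legendre_image_def legendre_emb_def Delta0_def Delta_def vec_eq_iff)
  with u assms(1) show "u \<in> legendre_emb \<psi> ` U"
    by (auto simp: legendre_image_def proj_x_eq_fst)
next
  fix u assume "u \<in> legendre_emb \<psi> ` U"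
  with assms(2) show "u \<in> legendre_image C \<psi>"
    by (auto simp: legendre_image_def legendre_emb_def Delta0_def Delta_def)
qed

lemma has_derivative_vec_lambda:
  fixes f :: "'n::finite \<Rightarrow> 'a::real_normed_vector \<Rightarrow> real"
  assumes "\<And>a. (f a has_derivative f' a) (at x)"
  shows "((\<lambda>x. \<chi> a. f a x) has_derivative (\<lambda>v. \<chi> a. f' a v)) (at x)"
proof -
  have "(\<chi> a. g a) = (\<Sum>a\<in>UNIV. g a *\<^sub>R axis a 1)" for g :: "'n \<Rightarrow> real"
    by (simp add: vec_eq_iff axis_def if_distrib cong: if_cong)
  then show ?thesis
    using assms by (auto intro!: has_derivative_sum has_derivative_scaleR_left)
qed

lemma has_derivative_legendre_emb:
  assumes "smooth_on U \<psi>" "x \<in> U"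
  shows "(legendre_emb \<psi> has_derivative (\<lambda>v. (v,
      \<chi> a. frechet_derivative (pderiv_vec \<psi> a) (at x) v, frechet_derivative \<psi> (at x) v))) (at x)"
  unfolding legendre_emb_def[abs_def]
proof (intro has_derivative_Pair has_derivative_ident smooth_on_has_derivative[OF assms])
  show "((\<lambda>x. \<chi> a. pderiv_vec \<psi> a x) has_derivative
      (\<lambda>v. \<chi> a. frechet_derivative (pderiv_vec \<psi> a) (at x) v)) (at x)"
    using smooth_on_has_derivative[OF smooth_on_pderiv_vec[OF assms(1)] assms(2)]
    by (rule has_derivative_vec_lambda)
qed

lemma smooth_on_legendre_emb:
  assumes "open U" "smooth_on U \<psi>"
  shows "smooth_on U (legendre_emb \<psi>)"
  unfolding smooth_on_def legendre_emb_def[abs_def]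
  by (intro allI Ck_on_Pair Ck_on_vec_lambda assms(1) bounded_linear_Ck_on[OF assms(1) bounded_linear_ident]
      smooth_onD[OF smooth_on_pderiv_vec[OF assms(2)]] smooth_onD[OF assms(2)])

text \<open>All \<Delta> terms vanish on the image and \<Gamma> 0 = 0 clears the last one. What
  remains is the derivative of the embedding applied to \<open>F x\<close>, which yields both
  tangency and the push-forward identity.\<close>

lemma lift_vf_legendre_emb:
  assumes "\<Gamma> 0 = 0"
  shows "lift_vf \<psi> F \<Gamma> (legendre_emb \<psi> x) = (F x,
      \<chi> a. frechet_derivative (pderiv_vec \<psi> a) (at x) (F x), frechet_derivative \<psi> (at x) (F x))"
  using assms by (simp add: lift_vf_def legendre_emb_def Delta_def Delta0_def)

text \<open>The witnessing curve is the image under \<open>f\<close> of the straight line through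
  \<open>x\<close> with velocity \<open>v\<close>, cut to a time interval on which the line stays in
  \<open>U\<close>.\<close>

lemma tangent_space_image:
  fixes f :: "'a::euclidean_space \<Rightarrow> 'b::real_normed_vector"
  assumes "open U" "smooth_on U f" "(f has_derivative f') (at x)" "x \<in> U"
  shows "f' v \<in> tangent_space (f ` U) (f x)"
proof -
  define c where "c = (\<lambda>t::real. x + t *\<^sub>R v)"
  have "open (c -` U)"
    unfolding c_def by (intro open_vimage assms(1) continuous_intros)
  moreover have "0 \<in> c -` U" using assms(4) by (simp add: c_def)
  ultimately obtain e where e: "e > 0" "ball 0 e \<subseteq> c -` U"
    using open_contains_ball by meson
  have sub: "c ` {-e<..<e} \<subseteq> U" using e(2) by (auto simp: ball_eq_greaterThanLessThan)
  have "smooth_on {-e<..<e} c"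
    unfolding smooth_on_def c_def
    by (intro allI Ck_on_add Ck_on_const bounded_linear_Ck_on bounded_linear_scaleR_left) auto
  then have "smooth_on {-e<..<e} (\<lambda>t. f (c t))"
    by (intro smooth_on_compose[OF _ assms(1) sub assms(2)]) auto
  moreover have "((\<lambda>t. f (c t)) has_vector_derivative f' v) (at 0)"
  proof -
    have "(c has_derivative (\<lambda>h. h *\<^sub>R v)) (at 0)"
      unfolding c_def by (auto intro!: derivative_eq_intros)
    then have "((\<lambda>t. f (c t)) has_derivative (\<lambda>h. f' (h *\<^sub>R v))) (at 0)"
      by (rule has_derivative_compose) (use assms(3) in \<open>simp add: c_def\<close>)
    then show ?thesis
      by (simp add: has_vector_derivative_def linear_scale[OF has_derivative_linear[OF assms(3)]])
  qed
  ultimately show ?thesis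
    unfolding tangent_space_def using e(1) sub
    by (intro CollectI exI[of _ e] conjI exI[of _ "\<lambda>t. f (c t)"]) (auto simp: c_def)
qed

theorem proposition4p1:
  fixes U :: "(real^'n::finite) set"
    and C :: "'n contact_pt set"
    and \<psi> :: "real^'n \<Rightarrow> real"
    and F :: "real^'n \<Rightarrow> real^'n"
    and \<Gamma> :: "real \<Rightarrow> real"
  assumes "open U" and "open C"
    and "proj_x ` C \<subseteq> U" and "legendre_emb \<psi> ` U \<subseteq> C"
    and "smooth_on U \<psi>" and "smooth_on U F" and "smooth_on UNIV \<Gamma>"
    and "\<forall>a. \<exists>x\<in>U. F x $ a \<noteq> 0"
  shows "\<exists>Xh. smooth_on C Xh \<and>
     lift_equations C \<psi> F \<Gamma> Xh \<and>
     (\<forall>Y. lift_equations C \<psi> F \<Gamma> Y \<longrightarrow> (\<forall>u\<in>C. Y u = Xh u)) \<and>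
     (\<forall>I \<gamma>. integral_curve Xh C I \<gamma> \<longrightarrow> (\<forall>t\<in>I.
        (\<forall>a. ((\<lambda>t. proj_x (\<gamma> t) $ a) has_real_derivative F (proj_x (\<gamma> t)) $ a) (at t)) \<and>
        (\<forall>a. ((\<lambda>t. Delta \<psi> a (\<gamma> t)) has_real_derivative
            - (\<Sum>b\<in>UNIV. pderiv_vec (\<lambda>x. F x $ b) a (proj_x (\<gamma> t)) * Delta \<psi> b (\<gamma> t))
            - deriv \<Gamma> (Delta0 \<psi> (\<gamma> t)) * Delta \<psi> a (\<gamma> t)) (at t)) \<and>
        ((\<lambda>t. Delta0 \<psi> (\<gamma> t)) has_real_derivative - \<Gamma> (Delta0 \<psi> (\<gamma> t))) (at t))) \<and>
     flow_lift proj_x Xh C F U \<and>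
     contact_hamiltonian_vf C (lift_hamiltonian \<psi> F \<Gamma>) Xh \<and>
     (\<forall>Y. contact_hamiltonian_vf C (lift_hamiltonian \<psi> F \<Gamma>) Y \<longrightarrow> (\<forall>u\<in>C. Y u = Xh u)) \<and>
     (\<Gamma> 0 = 0 \<and> (\<forall>s. s \<noteq> 0 \<longrightarrow> \<Gamma> s \<noteq> 0) \<longrightarrow>
       (let X0 = restrict Xh (legendre_image C \<psi>) in
          tangent_to X0 (legendre_image C \<psi>) \<and>
          pushes_forward proj_x C U Xh F \<and>
          pushes_forward (legendre_emb \<psi>) U (legendre_image C \<psi>) F X0))"
proof (intro exI[of _ "lift_vf \<psi> F \<Gamma>"] conjI)
  let ?X = "lift_vf \<psi> F \<Gamma>"
  note iff = lift_equations_iff[OF \<open>smooth_on U \<psi>\<close> \<open>proj_x ` C \<subseteq> U\<close>]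
  have inU: "fst u \<in> U" if "u \<in> C" for u
    using that \<open>proj_x ` C \<subseteq> U\<close> by (auto simp: proj_x_eq_fst)
  show smooth: "smooth_on C ?X"
    using assms by (intro smooth_on_lift_vf)
  show lift: "lift_equations C \<psi> F \<Gamma> ?X"
    by (simp add: iff)
  show "\<forall>Y. lift_equations C \<psi> F \<Gamma> Y \<longrightarrow> (\<forall>u\<in>C. Y u = ?X u)"
    by (simp add: iff)
  show "\<forall>I \<gamma>. integral_curve ?X C I \<gamma> \<longrightarrow> (\<forall>t\<in>I.
        (\<forall>a. ((\<lambda>t. proj_x (\<gamma> t) $ a) has_real_derivative F (proj_x (\<gamma> t)) $ a) (at t)) \<and>
        (\<forall>a. ((\<lambda>t. Delta \<psi> a (\<gamma> t)) has_real_derivative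
            - (\<Sum>b\<in>UNIV. pderiv_vec (\<lambda>x. F x $ b) a (proj_x (\<gamma> t)) * Delta \<psi> b (\<gamma> t))
            - deriv \<Gamma> (Delta0 \<psi> (\<gamma> t)) * Delta \<psi> a (\<gamma> t)) (at t)) \<and>
        ((\<lambda>t. Delta0 \<psi> (\<gamma> t)) has_real_derivative - \<Gamma> (Delta0 \<psi> (\<gamma> t))) (at t))"
  proof (intro allI impI ballI)
    fix I \<gamma> t assume \<gamma>: "integral_curve ?X C I \<gamma>" and t: "t \<in> I"
    then have C: "\<gamma> t \<in> C" by (auto simp: integral_curve_def)
    note deriv_along = integral_curve_has_real_derivative[OF \<gamma> t]
    have dx: "(\<lambda>u. proj_x u $ a) differentiable at (\<gamma> t)" for a
      unfolding proj_x_eq_fst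
      by (intro bounded_linear_imp_differentiable bounded_linear_compose[OF bounded_linear_vec_nth bounded_linear_fst])
    have dDelta: "Delta \<psi> a differentiable at (\<gamma> t)" for a
      using has_derivative_Delta[OF smooth_on_has_derivative[OF smooth_on_pderiv_vec[OF \<open>smooth_on U \<psi>\<close>] inU[OF C]]]
      by (rule differentiableI)
    have dDelta0: "Delta0 \<psi> differentiable at (\<gamma> t)"
      using has_derivative_Delta0[OF smooth_on_has_derivative[OF \<open>smooth_on U \<psi>\<close> inU[OF C]]]
      by (rule differentiableI)
    have eqs: "lie ?X (\<lambda>u. proj_x u $ a) (\<gamma> t) = F (proj_x (\<gamma> t)) $ a"
      "lie ?X (Delta \<psi> a) (\<gamma> t) =
        - (\<Sum>b\<in>UNIV. pderiv_vec (\<lambda>x. F x $ b) a (proj_x (\<gamma> t)) * Delta \<psi> b (\<gamma> t))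
        - deriv \<Gamma> (Delta0 \<psi> (\<gamma> t)) * Delta \<psi> a (\<gamma> t)"
      "lie ?X (Delta0 \<psi>) (\<gamma> t) = - \<Gamma> (Delta0 \<psi> (\<gamma> t))" for a
      using lift C unfolding lift_equations_def by blast+
    show "(\<forall>a. ((\<lambda>t. proj_x (\<gamma> t) $ a) has_real_derivative F (proj_x (\<gamma> t)) $ a) (at t)) \<and>
        (\<forall>a. ((\<lambda>t. Delta \<psi> a (\<gamma> t)) has_real_derivative
            - (\<Sum>b\<in>UNIV. pderiv_vec (\<lambda>x. F x $ b) a (proj_x (\<gamma> t)) * Delta \<psi> b (\<gamma> t))
            - deriv \<Gamma> (Delta0 \<psi> (\<gamma> t)) * Delta \<psi> a (\<gamma> t)) (at t)) \<and>
        ((\<lambda>t. Delta0 \<psi> (\<gamma> t)) has_real_derivative - \<Gamma> (Delta0 \<psi> (\<gamma> t))) (at t)"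
      using deriv_along[OF dx, unfolded eqs] deriv_along[OF dDelta, unfolded eqs]
        deriv_along[OF dDelta0, unfolded eqs]
      by (intro conjI allI)
  qed
  show "flow_lift proj_x ?X C F U"
    unfolding proj_x_eq_fst
    by (rule flow_lift_bounded_linear[OF \<open>open C\<close> \<open>open U\<close> smooth_onD[OF smooth]
          smooth_onD[OF \<open>smooth_on U F\<close>] bounded_linear_fst])
      (simp_all add: lift_vf_def image_subset_iff inU)
  show ham: "contact_hamiltonian_vf C (lift_hamiltonian \<psi> F \<Gamma>) ?X"
    using assms by (intro contact_hamiltonian_lift_vf)
  show "\<forall>Y. contact_hamiltonian_vf C (lift_hamiltonian \<psi> F \<Gamma>) Y \<longrightarrow> (\<forall>u\<in>C. Y u = ?X u)"
    using contact_hamiltonian_vf_unique[OF ham] by blast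
  show "\<Gamma> 0 = 0 \<and> (\<forall>s. s \<noteq> 0 \<longrightarrow> \<Gamma> s \<noteq> 0) \<longrightarrow>
       (let X0 = restrict ?X (legendre_image C \<psi>) in
          tangent_to X0 (legendre_image C \<psi>) \<and>
          pushes_forward proj_x C U ?X F \<and>
          pushes_forward (legendre_emb \<psi>) U (legendre_image C \<psi>) F X0)"
  proof
    assume "\<Gamma> 0 = 0 \<and> (\<forall>s. s \<noteq> 0 \<longrightarrow> \<Gamma> s \<noteq> 0)"
    then have \<Gamma>: "\<Gamma> 0 = 0" by blast
    have image: "legendre_image C \<psi> = legendre_emb \<psi> ` U"
      using assms by (intro legendre_image_eq)
    note emb = has_derivative_legendre_emb[OF \<open>smooth_on U \<psi>\<close>]
    have "tangent_to (restrict ?X (legendre_emb \<psi> ` U)) (legendre_emb \<psi> ` U)"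
      unfolding tangent_to_def
    proof
      fix u assume "u \<in> legendre_emb \<psi> ` U"
      then obtain x where "x \<in> U" "u = legendre_emb \<psi> x" by blast
      \<comment> \<open>Evaluation is only at points of the image, where \<open>restrict\<close>
        returns the field itself and not its default value.\<close>
      then show "restrict ?X (legendre_emb \<psi> ` U) u \<in> tangent_space (legendre_emb \<psi> ` U) u"
        using tangent_space_image[OF \<open>open U\<close> smooth_on_legendre_emb[OF \<open>open U\<close> \<open>smooth_on U \<psi>\<close>]
            emb[OF \<open>x \<in> U\<close>] \<open>x \<in> U\<close>, of "F x"]
        by (simp add: lift_vf_legendre_emb[of \<Gamma>, OF \<Gamma>])
    qed
    moreover have "pushes_forward proj_x C U ?X F"
    proof -
      have "fst ` C = U"
      proof
        \<comment> \<open>The embedding is a section of the projection with values in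
          \<open>C\<close>, so the projection is onto \<open>U\<close>.\<close>
        show "U \<subseteq> fst ` C"
          using \<open>legendre_emb \<psi> ` U \<subseteq> C\<close> by (force simp: legendre_emb_def)
      qed (simp add: image_subset_iff inU)
      have D: "(fst has_derivative fst) (at u)" for u :: "'n contact_pt"
        by (rule bounded_linear_imp_has_derivative[OF bounded_linear_fst])
      show ?thesis
        using \<open>fst ` C = U\<close> differentiableI[OF D] frechet_derivative_at[OF D, symmetric]
        by (simp add: pushes_forward_def proj_x_eq_fst lift_vf_def)
    qed
    moreover have "pushes_forward (legendre_emb \<psi>) U (legendre_emb \<psi> ` U) F
        (restrict ?X (legendre_emb \<psi> ` U))"
      using differentiableI[OF emb] frechet_derivative_at[OF emb, symmetric]
      by (simp add: pushes_forward_def lift_vf_legendre_emb[of \<Gamma>, OF \<Gamma>])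
    ultimately show "let X0 = restrict ?X (legendre_image C \<psi>) in
          tangent_to X0 (legendre_image C \<psi>) \<and>
          pushes_forward proj_x C U ?X F \<and>
          pushes_forward (legendre_emb \<psi>) U (legendre_image C \<psi>) F X0"
      unfolding Let_def image by blast
  qed
qed

end
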